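(* Let $d\ge1$, let $p_1,\dots,p_d$ be distinct primes, and let $\varphi(s)=\sigma+\sum_{j=1}^dr_jp_j^{-s}$ with $\sigma>\frac12$, $r_j\ge0$ and $R:=\sum_{j=1}^dr_j<\sigma-\frac12$. If $2R<\varepsilon<2\sigma-1$, then for all $N,M\in\mathbb N$ \[ 0\le\|C_\varphi\|^2-\lambda_{N,M}(\sigma,\boldsymbol r)\le E_N(\sigma,\boldsymbol r,\varepsilon)+\eta_{N,M}(\sigma,\boldsymbol r,\varepsilon), \] where \[ E_N(\sigma,\boldsymbol r,\varepsilon)=\zeta(2\sigma-\varepsilon)\,\frac{(4R^2/\varepsilon^2)^N}{1-4R^2/\varepsilon^2} \] and \[ \eta_{N,M}(\sigma,\boldsymbol r,\varepsilon)=\left(\sum_{j=0}^{N-1}\frac{(2j)!}{\varepsilon^{2j}}a_j(\boldsymbol r)^2\right)\frac{M^{-(2\sigma-\varepsilon-1)}}{2\sigma-\varepsilon-1}. \]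
   Context: $\mathbb N=\{1,2,\dots\}$. $\mathcal H^2$ is the Hilbert space of Dirichlet series $f(s)=\sum_{n\ge1}a_nn^{-s}$ with $\|f\|^2=\sum_n|a_n|^2<\infty$, analytic on $\{\operatorname{Re}s>1/2\}$; $\varphi$ maps $\{\operatorname{Re}s>0\}$ into $\{\operatorname{Re}s>1/2\}$ and $C_\varphi f=f\circ\varphi$ is the induced composition operator on $\mathcal H^2$ (bounded, by the Gordon–Hedenmalm theorem). $\zeta$ is the Riemann zeta function. For $\boldsymbol r=(r_1,\dots,r_d)$ and $\alpha\in\mathbb N_0^d$: $|\alpha|=\sum_j\alpha_j$, $\alpha!=\prod_j\alpha_j!$, $\boldsymbol r^\alpha=\prod_jr_j^{\alpha_j}$, $0^0=1$. For $j\in\mathbb N_0$, $a_j(\boldsymbol r)\ge0$ is defined by \[ a_j(\boldsymbol r)^2=\sum_{|\alpha|=j}\frac{\boldsymbol r^{2\alpha}}{(\alpha!)^2}. \] For $k\in\mathbb N_0$, $M\in\mathbb N$, $m_k^{(M)}(\sigma)=\sum_{n=1}^Mn^{-2\sigma}(\log n)^k$. The $N\times N$ real symmetric matrix \[ B^{(N,M)}_{\sigma,\boldsymbol r}=\left(m^{(M)}_{j+k}(\sigma)\,a_j(\boldsymbol r)a_k(\boldsymbol r)\right)_{0\le j,k\le N-1} \] has largest eigenvalue denoted $\lambda_{N,M}(\sigma,\boldsymbol r)=\lambda_{\max}(B^{(N,M)}_{\sigma,\boldsymbol r})$. *)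

theory Defs
  imports
    "HOL-Analysis.Analysis"
    "HOL-Computational_Algebra.Primes"
    "Jordan_Normal_Form.Spectral_Radius"
begin

section \<open>The Hilbert space of Dirichlet series with square-summable coefficients\<close>

text \<open>
  An element is given by its coefficients \<open>a\<^sub>1, a\<^sub>2, \<dots>\<close>; index 0 is not
  used and carries the value 0, so that sums over all natural numbers are sums over \<open>n \<ge> 1\<close>.
\<close>

typedef hardy_dirichlet =
  "{a :: nat \<Rightarrow> complex. a 0 = 0 \<and> summable (\<lambda>n. (cmod (a n))\<^sup>2)}"
  morphisms coeff_hd Abs_hardy_dirichlet
  by (rule exI[of _ "\<lambda>_. 0"]) simp

setup_lifting type_definition_hardy_dirichlet

lemma summable_norm_square_add:
  fixes a b :: "nat \<Rightarrow> complex"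
  assumes "summable (\<lambda>n. (cmod (a n))\<^sup>2)" "summable (\<lambda>n. (cmod (b n))\<^sup>2)"
  shows "summable (\<lambda>n. (cmod (a n + b n))\<^sup>2)"
proof (rule summable_comparison_test')
  show "summable (\<lambda>n. 2 * (cmod (a n))\<^sup>2 + 2 * (cmod (b n))\<^sup>2)"
    using assms by (intro summable_add summable_mult)
  fix n :: nat
  have "(cmod (a n + b n))\<^sup>2 \<le> (cmod (a n) + cmod (b n))\<^sup>2"
    by (simp add: norm_triangle_ineq power_mono)
  also have "\<dots> \<le> 2 * (cmod (a n))\<^sup>2 + 2 * (cmod (b n))\<^sup>2"
    using zero_le_power2[of "cmod (a n) - cmod (b n)"]
    by (simp add: power2_eq_square algebra_simps)
  finally show "norm ((cmod (a n + b n))\<^sup>2) \<le> 2 * (cmod (a n))\<^sup>2 + 2 * (cmod (b n))\<^sup>2"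
    by simp
qed

lemma summable_norm_square_scaleR:
  fixes a :: "nat \<Rightarrow> complex"
  assumes "summable (\<lambda>n. (cmod (a n))\<^sup>2)"
  shows "summable (\<lambda>n. (cmod (c *\<^sub>R a n))\<^sup>2)"
  using summable_mult[OF assms, of "c\<^sup>2"] by (simp add: power_mult_distrib)

lemma summable_inner_square:
  fixes a b :: "nat \<Rightarrow> complex"
  assumes "summable (\<lambda>n. (cmod (a n))\<^sup>2)" "summable (\<lambda>n. (cmod (b n))\<^sup>2)"
  shows "summable (\<lambda>n. inner (a n) (b n))"
proof (rule summable_comparison_test')
  show "summable (\<lambda>n. (cmod (a n))\<^sup>2 + (cmod (b n))\<^sup>2)"
    using assms by (intro summable_add)
  fix n :: nat
  have "\<bar>inner (a n) (b n)\<bar> \<le> cmod (a n) * cmod (b n)"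
    by (rule Cauchy_Schwarz_ineq2)
  also have "\<dots> \<le> (cmod (a n))\<^sup>2 + (cmod (b n))\<^sup>2"
    using sum_squares_bound[of "cmod (a n)" "cmod (b n)"]
      mult_nonneg_nonneg[OF norm_ge_zero[of "a n"] norm_ge_zero[of "b n"]]
    by linarith
  finally show "norm (inner (a n) (b n)) \<le> (cmod (a n))\<^sup>2 + (cmod (b n))\<^sup>2"
    by simp
qed

text \<open>
  The inner product below is the real part of \<open>\<Sum>\<^sub>n a\<^sub>n * cnj b\<^sub>n\<close>; it induces
  the same norm.
\<close>

instantiation hardy_dirichlet :: real_inner
begin

lift_definition zero_hardy_dirichlet :: hardy_dirichlet is "\<lambda>_. 0" by simp

lift_definition plus_hardy_dirichlet ::
    "hardy_dirichlet \<Rightarrow> hardy_dirichlet \<Rightarrow> hardy_dirichlet" is "\<lambda>a b n. a n + b n"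
  by (simp add: summable_norm_square_add)

lift_definition scaleR_hardy_dirichlet ::
    "real \<Rightarrow> hardy_dirichlet \<Rightarrow> hardy_dirichlet" is "\<lambda>c a n. c *\<^sub>R a n"
  using summable_norm_square_scaleR by auto

lift_definition uminus_hardy_dirichlet ::
    "hardy_dirichlet \<Rightarrow> hardy_dirichlet" is "\<lambda>a n. - a n"
  by simp

lift_definition minus_hardy_dirichlet ::
    "hardy_dirichlet \<Rightarrow> hardy_dirichlet \<Rightarrow> hardy_dirichlet" is "\<lambda>a b n. a n - b n"
proof -
  fix a b :: "nat \<Rightarrow> complex"
  assume "a 0 = 0 \<and> summable (\<lambda>n. (cmod (a n))\<^sup>2)" "b 0 = 0 \<and> summable (\<lambda>n. (cmod (b n))\<^sup>2)"
  then show "a 0 - b 0 = 0 \<and> summable (\<lambda>n. (cmod (a n - b n))\<^sup>2)"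
    using summable_norm_square_add[of a "\<lambda>n. - b n"] by simp
qed

definition norm_hardy_dirichlet :: "hardy_dirichlet \<Rightarrow> real" where
  "norm_hardy_dirichlet f = sqrt (\<Sum>n. (cmod (coeff_hd f n))\<^sup>2)"

definition inner_hardy_dirichlet :: "hardy_dirichlet \<Rightarrow> hardy_dirichlet \<Rightarrow> real" where
  "inner_hardy_dirichlet f g = (\<Sum>n. inner (coeff_hd f n) (coeff_hd g n))"

definition dist_hardy_dirichlet :: "hardy_dirichlet \<Rightarrow> hardy_dirichlet \<Rightarrow> real" where
  "dist_hardy_dirichlet f g = norm (f - g)"

definition sgn_hardy_dirichlet :: "hardy_dirichlet \<Rightarrow> hardy_dirichlet" where
  "sgn_hardy_dirichlet f = inverse (norm f) *\<^sub>R f"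

definition uniformity_hardy_dirichlet :: "(hardy_dirichlet \<times> hardy_dirichlet) filter" where
  "uniformity_hardy_dirichlet =
     (INF e\<in>{0<..}. principal {(f, g). dist f (g :: hardy_dirichlet) < e})"

definition open_hardy_dirichlet :: "hardy_dirichlet set \<Rightarrow> bool" where
  "open_hardy_dirichlet U \<longleftrightarrow>
     (\<forall>f\<in>U. eventually (\<lambda>(f', g). f' = f \<longrightarrow> g \<in> U) uniformity)"

instance
proof
  fix f g h :: hardy_dirichlet and c d :: real and U :: "hardy_dirichlet set"
  show "f + g + h = f + (g + h)" by transfer (simp add: algebra_simps)
  show "f + g = g + f" by transfer (simp add: algebra_simps)
  show "0 + f = f" by transfer simp
  show "- f + f = 0" by transfer simp
  show "f - g = f + - g" by transfer simp
  show "c *\<^sub>R (f + g) = c *\<^sub>R f + c *\<^sub>R g" by transfer (simp add: algebra_simps)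
  show "(c + d) *\<^sub>R f = c *\<^sub>R f + d *\<^sub>R f" by transfer (simp add: algebra_simps)
  show "c *\<^sub>R d *\<^sub>R f = (c * d) *\<^sub>R f" by transfer simp
  show "1 *\<^sub>R f = f" by transfer simp
  show "sgn f = inverse (norm f) *\<^sub>R f" by (simp add: sgn_hardy_dirichlet_def)
  show "dist f g = norm (f - g)" by (simp add: dist_hardy_dirichlet_def)
  show "(uniformity :: (hardy_dirichlet \<times> hardy_dirichlet) filter) =
      (INF e\<in>{0<..}. principal {(f, g). dist f g < e})"
    by (simp add: uniformity_hardy_dirichlet_def)
  show "open U \<longleftrightarrow> (\<forall>f\<in>U. \<forall>\<^sub>F (f', g) in uniformity. f' = f \<longrightarrow> g \<in> U)"
    by (simp add: open_hardy_dirichlet_def)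
  have sm: "summable (\<lambda>n. (cmod (coeff_hd u n))\<^sup>2)" for u
    using coeff_hd[of u] by simp
  show "inner f g = inner g f"
    by (simp add: inner_hardy_dirichlet_def inner_commute)
  show "inner (f + g) h = inner f h + inner g h"
    by (simp add: inner_hardy_dirichlet_def plus_hardy_dirichlet.rep_eq inner_add_left
        suminf_add summable_inner_square sm)
  show "inner (c *\<^sub>R f) g = c * inner f g"
    by (simp add: inner_hardy_dirichlet_def scaleR_hardy_dirichlet.rep_eq
        suminf_mult summable_inner_square sm)
  show "0 \<le> inner f f"
    unfolding inner_hardy_dirichlet_def
    by (intro suminf_nonneg summable_inner_square sm) simp
  show "inner f f = 0 \<longleftrightarrow> f = 0"
  proof -
    have "inner f f = 0 \<longleftrightarrow> (\<forall>n. inner (coeff_hd f n) (coeff_hd f n) = 0)"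
      unfolding inner_hardy_dirichlet_def
      by (intro suminf_eq_zero_iff summable_inner_square sm) simp
    also have "\<dots> \<longleftrightarrow> f = 0"
      by (simp add: coeff_hd_inject[symmetric] zero_hardy_dirichlet.rep_eq fun_eq_iff)
    finally show ?thesis .
  qed
  show "norm f = sqrt (inner f f)"
    by (simp add: norm_hardy_dirichlet_def inner_hardy_dirichlet_def power2_norm_eq_inner)
qed

end

text \<open>The analytic function represented by an element, for \<open>Re s > 1/2\<close>.\<close>

definition eval_hd :: "hardy_dirichlet \<Rightarrow> complex \<Rightarrow> complex" where
  "eval_hd f s = (\<Sum>n. coeff_hd f n * of_nat n powr (- s))"

text \<open>
  \<open>C\<^sub>\<phi> f = f \<circ> \<phi>\<close>: the element that represents \<open>f \<circ> \<phi>\<close> on \<open>Re s > 1/2\<close>. It is unique,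
  since a Dirichlet series is determined by its values on a half-plane; it exists for every
  symbol inducing a composition operator on the space. The operator is complex linear, and
  its operator norm is \<^const>\<open>onorm\<close>, which does not depend on the scalar field.
\<close>

definition composition_hd :: "(complex \<Rightarrow> complex) \<Rightarrow> hardy_dirichlet \<Rightarrow> hardy_dirichlet" where
  "composition_hd \<phi> f = (THE g. \<forall>s. Re s > 1/2 \<longrightarrow> eval_hd g s = eval_hd f (\<phi> s))"


section \<open>The finite matrices\<close>

text \<open>Only the Dirichlet series of the zeta function is needed, at real \<open>x > 1\<close>.\<close>

definition zeta_real :: "real \<Rightarrow> real" where
  "zeta_real x = (\<Sum>n. 1 / real (Suc n) powr x)"

text \<open>Multi-indices \<open>\<alpha> = (\<alpha>\<^sub>1, \<dots>, \<alpha>\<^sub>d)\<close> with \<open>|\<alpha>| = j\<close>.\<close>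

definition multi_indices :: "nat \<Rightarrow> nat \<Rightarrow> (nat \<Rightarrow> nat) set" where
  "multi_indices d j = {\<alpha> \<in> {1..d} \<rightarrow>\<^sub>E UNIV. (\<Sum>i=1..d. \<alpha> i) = j}"

definition a_coeff :: "nat \<Rightarrow> (nat \<Rightarrow> real) \<Rightarrow> nat \<Rightarrow> real" where
  "a_coeff d r j =
     sqrt (\<Sum>\<alpha>\<in>multi_indices d j. (\<Prod>i=1..d. r i ^ (2 * \<alpha> i)) / (\<Prod>i=1..d. fact (\<alpha> i))\<^sup>2)"

definition log_moment :: "nat \<Rightarrow> nat \<Rightarrow> real \<Rightarrow> real" where
  "log_moment M k \<sigma> = (\<Sum>n=1..M. real n powr (- 2 * \<sigma>) * ln (real n) ^ k)"

definition B_mat :: "nat \<Rightarrow> nat \<Rightarrow> real \<Rightarrow> nat \<Rightarrow> (nat \<Rightarrow> real) \<Rightarrow> real mat" where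
  "B_mat N M \<sigma> d r =
     mat N N (\<lambda>(j, k). log_moment M (j + k) \<sigma> * a_coeff d r j * a_coeff d r k)"

text \<open>For \<open>N \<ge> 1\<close> the matrix is real symmetric, so its spectrum is finite and nonempty.\<close>

definition lambda_max :: "nat \<Rightarrow> nat \<Rightarrow> real \<Rightarrow> nat \<Rightarrow> (nat \<Rightarrow> real) \<Rightarrow> real" where
  "lambda_max N M \<sigma> d r = Max (spectrum (B_mat N M \<sigma> d r))"

definition E_error :: "nat \<Rightarrow> real \<Rightarrow> nat \<Rightarrow> (nat \<Rightarrow> real) \<Rightarrow> real \<Rightarrow> real" where
  "E_error N \<sigma> d r \<epsilon> =
     (let q = 4 * (\<Sum>i=1..d. r i)\<^sup>2 / \<epsilon>\<^sup>2 in zeta_real (2 * \<sigma> - \<epsilon>) * (q ^ N / (1 - q)))"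

definition eta_error :: "nat \<Rightarrow> nat \<Rightarrow> real \<Rightarrow> nat \<Rightarrow> (nat \<Rightarrow> real) \<Rightarrow> real \<Rightarrow> real" where
  "eta_error N M \<sigma> d r \<epsilon> =
     (\<Sum>j<N. fact (2 * j) / \<epsilon> ^ (2 * j) * (a_coeff d r j)\<^sup>2)
       * (real M powr (- (2 * \<sigma> - \<epsilon> - 1)) / (2 * \<sigma> - \<epsilon> - 1))"

end

(* The substituted series f o phi has coefficient (-1)^|alpha| (r^alpha / alpha!) L_|alpha| f at p^alpha,
   where L_j f = sum_n a_n n^-sigma (log n)^j. By unique factorization these frequencies are distinct, so
   ||C f||^2 = sum_j a_j(r)^2 |L_j f|^2: the norm of C is that of the infinite matrix with entries
   a_j n^-sigma (log n)^j, and B^(N,M) is the Gram matrix of its upper left N x M corner.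
   Passing to the corner can only lower the norm, which gives the lower bound. For the upper bound the rows
   j >= N and the columns n > M are estimated by their Hilbert-Schmidt norms, using
   (log n)^(2j) <= (2j)! n^eps / eps^(2j) and a_j(r) <= R^j / j!. *)
theory Submission
  imports Defs
begin

section \<open>Logarithmic weights\<close>

text \<open>\<open>composition_hd\<close> is a definite description and \<open>onorm\<close> a real
  supremum, so existence and uniqueness of the image series and boundedness of the operator are
  proved here instead of quoted. The condition R < \<sigma> - 1/2 gives existence: \<phi>(s) =
  \<sigma> - z with |z| \<le> R when Re s > 1/2, so the Taylor series of f at \<sigma> converges
  absolutely and may be regrouped by monomials. The two quoted estimates leave the factor (2j)! /
  (j!)^2 \<le> 4^j, whence the ratio 4R^2/\<epsilon>^2, which is below 1 because 2R < \<epsilon>;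
  \<epsilon> < 2\<sigma> - 1 keeps the zeta series convergent. The errors add without a cross term
  of order sqrt(\<lambda>\<eta>): the columns n \<le> M and n > M see orthogonal parts of f, and the
  squared norm of the image is a sum over rows. The matrix is real but the coefficients are complex:
  the largest eigenvalue is found variationally over the reals, and real and imaginary parts are
  then bounded separately.\<close>

lemma Cauchy_Schwarz_suminf:
  fixes a :: "nat \<Rightarrow> complex" and b :: "nat \<Rightarrow> real"
  assumes a: "summable (\<lambda>n. (cmod (a n))\<^sup>2)" and b: "summable (\<lambda>n. (b n)\<^sup>2)"
  shows "summable (\<lambda>n. cmod (a n) * \<bar>b n\<bar>)"
    and "(cmod (\<Sum>n. a n * of_real (b n)))\<^sup>2 \<le> (\<Sum>n. (cmod (a n))\<^sup>2) * (\<Sum>n. (b n)\<^sup>2)"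
proof -
  show sm: "summable (\<lambda>n. cmod (a n) * \<bar>b n\<bar>)"
  proof (rule summable_comparison_test')
    show "summable (\<lambda>n. (cmod (a n))\<^sup>2 + (b n)\<^sup>2)"
      using a b by (rule summable_add)
    fix n :: nat
    show "norm (cmod (a n) * \<bar>b n\<bar>) \<le> (cmod (a n))\<^sup>2 + (b n)\<^sup>2"
      using sum_squares_bound[of "cmod (a n)" "\<bar>b n\<bar>"]
        mult_nonneg_nonneg[OF norm_ge_zero[of "a n"] abs_ge_zero[of "b n"]]
      unfolding power2_abs real_norm_def abs_mult abs_abs abs_norm_cancel by linarith
  qed
  have bound: "(\<Sum>n<k. cmod (a n) * \<bar>b n\<bar>)\<^sup>2 \<le> (\<Sum>n. (cmod (a n))\<^sup>2) * (\<Sum>n. (b n)\<^sup>2)" for k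
  proof -
    have "(\<Sum>n<k. cmod (a n) * \<bar>b n\<bar>)\<^sup>2 \<le> (\<Sum>n<k. (cmod (a n))\<^sup>2) * (\<Sum>n<k. \<bar>b n\<bar>\<^sup>2)"
      by (rule Cauchy_Schwarz_ineq_sum)
    also have "\<dots> \<le> (\<Sum>n. (cmod (a n))\<^sup>2) * (\<Sum>n. (b n)\<^sup>2)"
      using a b by (intro mult_mono) (auto intro!: sum_le_suminf suminf_nonneg sum_nonneg)
    finally show ?thesis .
  qed
  have "(\<lambda>k. (\<Sum>n<k. cmod (a n) * \<bar>b n\<bar>)\<^sup>2) \<longlonglongrightarrow> (\<Sum>n. cmod (a n) * \<bar>b n\<bar>)\<^sup>2"
    by (intro tendsto_power summable_LIMSEQ sm)
  then have le: "(\<Sum>n. cmod (a n) * \<bar>b n\<bar>)\<^sup>2 \<le> (\<Sum>n. (cmod (a n))\<^sup>2) * (\<Sum>n. (b n)\<^sup>2)"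
    by (rule LIMSEQ_le_const2) (use bound in auto)
  have "cmod (\<Sum>n. a n * of_real (b n)) \<le> (\<Sum>n. cmod (a n) * \<bar>b n\<bar>)"
    using summable_norm[of "\<lambda>n. a n * of_real (b n)"] sm by (simp add: norm_mult)
  then show "(cmod (\<Sum>n. a n * of_real (b n)))\<^sup>2 \<le> (\<Sum>n. (cmod (a n))\<^sup>2) * (\<Sum>n. (b n)\<^sup>2)"
    using le power_mono[of "cmod (\<Sum>n. a n * of_real (b n))" _ 2] by (meson norm_ge_zero order_trans)
qed

section \<open>The zeta series and its tails\<close>

lemma summable_powr_minus:
  fixes x :: real
  assumes "x > 1"
  shows "summable (\<lambda>n. real n powr - x)"
  using assms by (simp add: summable_real_powr_iff)

text \<open>Index 0 contributes 0 because \<open>0 powr - x = 0\<close>; by this convention series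
  over n \<ge> 1 can run over all naturals.\<close>

lemma zeta_real_eq:
  assumes "x > 1"
  shows "zeta_real x = (\<Sum>n. real n powr - x)"
proof -
  have "(\<Sum>n. real n powr - x) = (\<Sum>n. real (Suc n) powr - x)"
    using suminf_split_head[OF summable_powr_minus[OF assms]] by simp
  then show ?thesis
    by (simp add: zeta_real_def powr_minus divide_inverse)
qed

text \<open>Discrete counterpart of comparing with the integral of t^(-x) over [n, n+1]. It is 1 + y
  \<le> exp y at y = (x-1) ln((n+1)/n), combined with ln((n+1)/n) \<ge> 1/(n+1) and multiplied by
  (n+1)^(-(x-1)).\<close>

lemma powr_minus_telescope:
  fixes x :: real
  assumes "x > 1" "n \<ge> 1"
  shows "(x - 1) * real (Suc n) powr - x \<le> real n powr - (x - 1) - real (Suc n) powr - (x - 1)"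
proof -
  let ?m = "real (Suc n)"
  have "ln (real n / ?m) \<le> real n / ?m - 1"
    using assms by (intro ln_le_minus_one) auto
  also have "\<dots> = - 1 / ?m" by (simp add: field_simps)
  finally have l: "- ln (real n / ?m) \<ge> 1 / ?m" by simp
  have "1 + (x - 1) / ?m \<le> 1 + (x - 1) * - ln (real n / ?m)"
    using mult_left_mono[OF l, of "x - 1"] assms by simp
  also have "\<dots> \<le> exp ((x - 1) * - ln (real n / ?m))"
    by (rule exp_ge_add_one_self)
  also have "\<dots> = (real n / ?m) powr - (x - 1)"
    unfolding powr_def using assms by (simp add: algebra_simps del: of_nat_Suc)
  also have "\<dots> = real n powr - (x - 1) / ?m powr - (x - 1)"
    by (rule powr_divide)
  finally have "(1 + (x - 1) / ?m) * ?m powr - (x - 1) \<le> real n powr - (x - 1)"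
    by (simp add: pos_le_divide_eq del: of_nat_Suc)
  moreover have "?m powr - (x - 1) / ?m = ?m powr - x"
    using powr_diff[of ?m "- (x - 1)" 1] by (simp del: of_nat_Suc)
  ultimately show ?thesis
    by (simp add: distrib_right del: of_nat_Suc flip: times_divide_eq_right)
qed

lemma powr_minus_tail_le:
  fixes x :: real
  assumes x: "x > 1" and M: "M \<ge> 1"
  shows "(\<Sum>n. real (n + Suc M) powr - x) \<le> real M powr - (x - 1) / (x - 1)"
proof (rule suminf_le_const)
  show "summable (\<lambda>n. real (n + Suc M) powr - x)"
    using summable_powr_minus[OF x] by (rule summable_ignore_initial_segment)
  fix k
  have "(x - 1) * (\<Sum>n<k. real (n + Suc M) powr - x)
      \<le> real M powr - (x - 1) - real (k + M) powr - (x - 1)"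
  proof (induction k)
    case (Suc k)
    then show ?case
      using powr_minus_telescope[OF x, of "k + M"] M by (simp add: algebra_simps)
  qed simp
  also have "\<dots> \<le> real M powr - (x - 1)" by simp
  finally show "(\<Sum>n<k. real (n + Suc M) powr - x) \<le> real M powr - (x - 1) / (x - 1)"
    using x by (simp add: pos_le_divide_eq mult.commute del: of_nat_Suc)
qed

text \<open>A single term of the exponential series of \<epsilon> * ln x, all of whose terms are
  nonnegative because x \<ge> 1.\<close>

lemma ln_power_le:
  fixes \<epsilon> x :: real
  assumes "\<epsilon> > 0" "x \<ge> 1"
  shows "ln x ^ k \<le> fact k / \<epsilon> ^ k * x powr \<epsilon>"
proof -
  have y: "0 \<le> \<epsilon> * ln x" using assms by simp
  have "(\<Sum>n\<in>{k}. (\<epsilon> * ln x) ^ n /\<^sub>R fact n) \<le> (\<Sum>n. (\<epsilon> * ln x) ^ n /\<^sub>R fact n)"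
    using y by (intro sum_le_suminf summable_exp_generic) auto
  then have "(\<epsilon> * ln x) ^ k / fact k \<le> exp (\<epsilon> * ln x)"
    by (simp add: exp_def divide_inverse mult.commute)
  also have "\<dots> = x powr \<epsilon>" using assms by (simp add: powr_def)
  finally show ?thesis
    using assms by (simp add: power_mult_distrib pos_divide_le_eq pos_le_divide_eq mult_ac)
qed

text \<open>This is the coefficient of z^j / j! in n^(z - \<sigma>). The convention
  \<open>0 powr _ = 0\<close> makes it vanish at n = 0, even for j = 0.\<close>

definition log_weight :: "real \<Rightarrow> nat \<Rightarrow> nat \<Rightarrow> real" where
  "log_weight \<sigma> j n = real n powr - \<sigma> * ln (real n) ^ j"

lemma log_weight_0 [simp]: "log_weight \<sigma> j 0 = 0"
  by (simp add: log_weight_def)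

lemma log_weight_nonneg [simp]: "log_weight \<sigma> j n \<ge> 0"
  by (cases "n = 0") (auto simp: log_weight_def)

lemma log_weight_mult:
  "log_weight \<sigma> j n * log_weight \<sigma> k n = real n powr (- 2 * \<sigma>) * ln (real n) ^ (j + k)"
  using powr_add[of "real n" "- \<sigma>" "- \<sigma>"] by (simp add: log_weight_def power_add)

lemma log_weight_square_le:
  assumes "\<epsilon> > 0"
  shows "(log_weight \<sigma> j n)\<^sup>2 \<le> fact (2 * j) / \<epsilon> ^ (2 * j) * real n powr - (2 * \<sigma> - \<epsilon>)"
proof (cases "n = 0")
  case False
  have "(log_weight \<sigma> j n)\<^sup>2 = ln (real n) ^ (2 * j) * real n powr (- 2 * \<sigma>)"
    using log_weight_mult[of \<sigma> j n j] by (simp add: power2_eq_square flip: mult_2)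
  also have "\<dots> \<le> (fact (2 * j) / \<epsilon> ^ (2 * j) * real n powr \<epsilon>) * real n powr (- 2 * \<sigma>)"
    using False assms by (intro mult_right_mono ln_power_le) auto
  also have "\<dots> = fact (2 * j) / \<epsilon> ^ (2 * j) * real n powr - (2 * \<sigma> - \<epsilon>)"
    using powr_add[of "real n" \<epsilon> "- 2 * \<sigma>"] by (simp add: mult.assoc)
  finally show ?thesis .
qed simp

lemma
  assumes "0 < \<epsilon>" "\<epsilon> < 2 * \<sigma> - 1"
  shows summable_log_weight_square: "summable (\<lambda>n. (log_weight \<sigma> j n)\<^sup>2)"
    and suminf_log_weight_square_le:
      "(\<Sum>n. (log_weight \<sigma> j n)\<^sup>2) \<le> fact (2 * j) / \<epsilon> ^ (2 * j) * zeta_real (2 * \<sigma> - \<epsilon>)"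
    and log_weight_square_tail_le: "M \<ge> 1 \<Longrightarrow> (\<Sum>n. (log_weight \<sigma> j (n + Suc M))\<^sup>2)
        \<le> fact (2 * j) / \<epsilon> ^ (2 * j) * (real M powr - (2 * \<sigma> - \<epsilon> - 1) / (2 * \<sigma> - \<epsilon> - 1))"
proof -
  let ?c = "fact (2 * j) / \<epsilon> ^ (2 * j)"
  have x: "2 * \<sigma> - \<epsilon> > 1" using assms by simp
  have sm: "summable (\<lambda>n. ?c * real n powr - (2 * \<sigma> - \<epsilon>))"
    by (intro summable_mult summable_powr_minus x)
  show sw: "summable (\<lambda>n. (log_weight \<sigma> j n)\<^sup>2)"
    by (rule summable_comparison_test'[OF sm]) (use log_weight_square_le[OF assms(1)] in simp)
  have "(\<Sum>n. (log_weight \<sigma> j n)\<^sup>2) \<le> (\<Sum>n. ?c * real n powr - (2 * \<sigma> - \<epsilon>))"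
    by (intro suminf_le sw sm log_weight_square_le assms)
  then show "(\<Sum>n. (log_weight \<sigma> j n)\<^sup>2) \<le> ?c * zeta_real (2 * \<sigma> - \<epsilon>)"
    using suminf_mult[OF summable_powr_minus[OF x], of ?c] by (simp only: zeta_real_eq[OF x])
  assume M: "M \<ge> 1"
  have "(\<Sum>n. (log_weight \<sigma> j (n + Suc M))\<^sup>2) \<le> (\<Sum>n. ?c * real (n + Suc M) powr - (2 * \<sigma> - \<epsilon>))"
    by (intro suminf_le summable_ignore_initial_segment[OF sw]
        summable_ignore_initial_segment[OF sm] log_weight_square_le assms)
  also have "\<dots> = ?c * (\<Sum>n. real (n + Suc M) powr - (2 * \<sigma> - \<epsilon>))"
    by (intro suminf_mult summable_ignore_initial_segment summable_powr_minus x)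
  also have "\<dots> \<le> ?c * (real M powr - (2 * \<sigma> - \<epsilon> - 1) / (2 * \<sigma> - \<epsilon> - 1))"
    using powr_minus_tail_le[OF x M] assms by (intro mult_left_mono) auto
  finally show "(\<Sum>n. (log_weight \<sigma> j (n + Suc M))\<^sup>2)
      \<le> ?c * (real M powr - (2 * \<sigma> - \<epsilon> - 1) / (2 * \<sigma> - \<epsilon> - 1))" .
qed

section \<open>Gram matrices and their largest eigenvalue\<close>

text \<open>Vectors of length N are encoded as functions on \<open>nat\<close> vanishing from N on,
  so that N can be a term. Compactness of the sphere is then Tychonoff's theorem: it is a closed
  subset of a product of intervals and singletons.\<close>

lemma max_on_unit_sphere_attained:
  fixes q :: "(nat \<Rightarrow> real) \<Rightarrow> real"
  assumes N: "N \<ge> (1::nat)" and q: "continuous_on UNIV q"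
  obtains u where "\<And>i. i \<ge> N \<Longrightarrow> u i = 0" "(\<Sum>i<N. (u i)\<^sup>2) = 1"
    "\<And>v. (\<And>i. i \<ge> N \<Longrightarrow> v i = 0) \<Longrightarrow> (\<Sum>i<N. (v i)\<^sup>2) = 1 \<Longrightarrow> q v \<le> q u"
proof -
  let ?X = "\<lambda>i. if i < N then {-1..1} else {0::real}"
  define S where "S = PiE UNIV ?X \<inter> {v. (\<Sum>i<N. (v i)\<^sup>2) = (1::real)}"
  have "compactin (product_topology (\<lambda>_::nat. euclidean :: real topology) UNIV) (PiE UNIV ?X)"
    by (auto simp: compactin_PiE)
  then have "compact (PiE UNIV ?X)"
    by (simp add: euclidean_product_topology)
  moreover have "closed {v. (\<Sum>i<N. (v i)\<^sup>2) = (1::real)}"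
    by (intro closed_Collect_eq continuous_intros continuous_on_product_coordinates)
  ultimately have "compact S"
    unfolding S_def by (rule compact_Int_closed)
  moreover have "(\<lambda>i. if i = 0 then 1 else 0) \<in> S"
    using N by (auto simp: S_def if_distrib[of "\<lambda>x. x\<^sup>2"] cong: if_cong)
  then have "S \<noteq> {}" by blast
  ultimately obtain u where u: "u \<in> S" "\<And>v. v \<in> S \<Longrightarrow> q v \<le> q u"
    using continuous_attains_sup[of S q] continuous_on_subset[OF q] by auto
  \<comment> \<open>The box cuts nothing off the sphere: each squared coordinate is at most the
    total 1.\<close>
  have mem: "v \<in> S" if "\<And>i. i \<ge> N \<Longrightarrow> v i = 0" "(\<Sum>i<N. (v i)\<^sup>2) = 1" for v
  proof -
    have "\<bar>v i\<bar> \<le> 1" if "i < N" for i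
      using member_le_sum[of i "{..<N}" "\<lambda>i. (v i)\<^sup>2"] \<open>(\<Sum>i<N. (v i)\<^sup>2) = 1\<close> that
      by (simp add: abs_square_le_1)
    then show ?thesis
      using that by (auto simp: S_def not_less abs_le_iff minus_le_iff)
  qed
  show ?thesis
  proof (rule that)
    show "u i = 0" if "i \<ge> N" for i
      using u(1) that by (auto simp: S_def PiE_iff dest: spec[of _ i])
    show "(\<Sum>i<N. (u i)\<^sup>2) = 1" using u(1) by (simp add: S_def)
    show "q v \<le> q u" if "\<And>i. i \<ge> N \<Longrightarrow> v i = 0" "(\<Sum>i<N. (v i)\<^sup>2) = 1" for v
      using u(2) mem that by blast
  qed
qed

text \<open>For small t of sign opposite to b the linear term would dominate and make the expression
  negative.\<close>

lemma linear_coefficient_eq_0: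
  fixes b c :: real
  assumes "\<And>t. 0 \<le> 2 * t * b + t\<^sup>2 * c"
  shows "b = 0"
proof -
  \<comment> \<open>t = -x is small enough, since c < 2(|c| + 1) whatever the sign of c.\<close>
  define x where "x = b / (\<bar>c\<bar> + 1)"
  have b: "b = (\<bar>c\<bar> + 1) * x" by (simp add: x_def)
  have "0 \<le> 2 * (- x) * b + (- x)\<^sup>2 * c" by (rule assms)
  also have "\<dots> = x\<^sup>2 * (c - 2 * (\<bar>c\<bar> + 1))"
    by (simp add: b power2_eq_square algebra_simps)
  finally have "x = 0"
    by (smt (verit) mult_pos_neg zero_less_power2)
  then show ?thesis by (simp add: b)
qed

text \<open>Translates the dimension-carrying vectors behind \<open>spectrum\<close> into finite
  sums over plain functions, on which the variational argument runs.\<close>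

lemma eigenvalue_mat_iff:
  fixes b :: "nat \<Rightarrow> nat \<Rightarrow> real"
  shows "eigenvalue (mat N N (\<lambda>(i, j). b i j)) \<mu> \<longleftrightarrow>
    (\<exists>v. (\<exists>i<N. v i \<noteq> 0) \<and> (\<forall>i<N. (\<Sum>j<N. b i j * v j) = \<mu> * v i))"
proof
  assume "eigenvalue (mat N N (\<lambda>(i, j). b i j)) \<mu>"
  then obtain x where x: "x \<in> carrier_vec N" "x \<noteq> 0\<^sub>v N"
      "mat N N (\<lambda>(i, j). b i j) *\<^sub>v x = \<mu> \<cdot>\<^sub>v x"
    by (auto simp: eigenvalue_def eigenvector_def)
  have "(\<Sum>j<N. b i j * x $ j) = \<mu> * x $ i" if "i < N" for i
    using arg_cong[OF x(3), of "\<lambda>y. y $ i"] that x(1)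
    by (simp add: scalar_prod_def lessThan_atLeast0)
  moreover have "\<exists>i<N. x $ i \<noteq> 0"
    using x(1,2) by (auto simp: vec_eq_iff)
  ultimately show "\<exists>v. (\<exists>i<N. v i \<noteq> 0) \<and> (\<forall>i<N. (\<Sum>j<N. b i j * v j) = \<mu> * v i)"
    by (intro exI[of _ "\<lambda>i. x $ i"]) auto
next
  assume "\<exists>v. (\<exists>i<N. v i \<noteq> 0) \<and> (\<forall>i<N. (\<Sum>j<N. b i j * v j) = \<mu> * v i)"
  then obtain v where v: "\<exists>i<N. v i \<noteq> 0" "\<forall>i<N. (\<Sum>j<N. b i j * v j) = \<mu> * v i" by blast
  have "eigenvector (mat N N (\<lambda>(i, j). b i j)) (vec N v) \<mu>"
    using v by (auto simp: eigenvector_def vec_eq_iff scalar_prod_def lessThan_atLeast0)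
  then show "eigenvalue (mat N N (\<lambda>(i, j). b i j)) \<mu>"
    by (auto simp: eigenvalue_def)
qed

text \<open>Lagrange multipliers: a maximizer of the quadratic form on the unit sphere is an
  eigenvector whose eigenvalue is the maximum. This yields a real eigenvalue dominating the form
  without diagonalizing the matrix.\<close>

lemma rayleigh_max_eigenvalue:
  fixes b :: "nat \<Rightarrow> nat \<Rightarrow> real"
  assumes N: "N \<ge> 1" and sym: "\<And>i j. b i j = b j i"
  obtains \<mu> where "eigenvalue (mat N N (\<lambda>(i, j). b i j)) \<mu>"
    "\<And>v. (\<Sum>i<N. \<Sum>j<N. b i j * v i * v j) \<le> \<mu> * (\<Sum>i<N. (v i)\<^sup>2)"
proof -
  define q where "q = (\<lambda>v. \<Sum>i<N. \<Sum>j<N. b i j * v i * v j)"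
  have "continuous_on UNIV q"
    unfolding q_def by (intro continuous_intros continuous_on_product_coordinates)
  then obtain u where u0: "\<And>i. i \<ge> N \<Longrightarrow> u i = 0" and u1: "(\<Sum>i<N. (u i)\<^sup>2) = 1"
    and umax: "\<And>v. (\<And>i. i \<ge> N \<Longrightarrow> v i = 0) \<Longrightarrow> (\<Sum>i<N. (v i)\<^sup>2) = 1 \<Longrightarrow> q v \<le> q u"
    using max_on_unit_sphere_attained[OF N] by blast
  have q_scale: "q (\<lambda>i. c * v i) = c\<^sup>2 * q v" for c v
    by (simp add: q_def sum_distrib_left power2_eq_square mult_ac)
  have q_max: "q v \<le> q u * (\<Sum>i<N. (v i)\<^sup>2)" for v
  proof (cases "(\<Sum>i<N. (v i)\<^sup>2) = 0")
    case True
    then have "\<forall>i<N. v i = 0" by (simp add: sum_nonneg_eq_0_iff)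
    then show ?thesis by (simp add: q_def)
  next
    case False
    define s where "s = (\<Sum>i<N. (v i)\<^sup>2)"
    have s: "s > 0" using False by (simp add: s_def less_le sum_nonneg)
    define w where "w = (\<lambda>i. if i < N then v i / sqrt s else 0)"
    have "(\<Sum>i<N. (w i)\<^sup>2) = s / s"
      using s by (simp add: w_def power_divide s_def flip: sum_divide_distrib)
    then have "q w \<le> q u" using s by (intro umax) (auto simp: w_def)
    moreover have "q w = q (\<lambda>i. (1 / sqrt s) * v i)" by (simp add: q_def w_def)
    ultimately show ?thesis
      using s q_scale[of "1 / sqrt s" v]
      by (simp add: power_divide pos_divide_le_eq flip: s_def)
  qed
  \<comment> \<open>the first-order condition at the maximizer \<open>u\<close>, in the direction of the unit vector \<open>e\<^sub>k\<close>\<close>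
  have "(\<Sum>j<N. b k j * u j) = q u * u k" if k: "k < N" for k
  proof -
    define e where "e = (\<lambda>i. if i = k then 1 else 0 :: real)"
    \<comment> \<open>The right side is \<open>q u\<close> times the squared norm of u + t e_k,
      minus the form at that point, hence nonnegative by \<open>q_max\<close>. The constant terms
      cancel because u is a unit vector.\<close>
    have "0 \<le> 2 * t * (q u * u k - (\<Sum>j<N. b k j * u j)) + t\<^sup>2 * (q u - b k k)" for t
    proof -
      have e1: "(\<Sum>i<N. e i * f i) = f k" for f :: "nat \<Rightarrow> real"
        using k by (simp add: e_def if_distrib[of "\<lambda>x. x * _"] cong: if_cong)
      have "(\<Sum>i<N. (u i + t * e i)\<^sup>2) = (\<Sum>i<N. (u i)\<^sup>2 + 2 * t * (e i * u i) + t\<^sup>2 * (e i * e i))"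
        by (simp add: power2_eq_square algebra_simps)
      also have "\<dots> = 1 + 2 * t * u k + t\<^sup>2"
        by (simp only: sum.distrib u1 e1 flip: sum_distrib_left) (simp add: e_def)
      finally have n: "(\<Sum>i<N. (u i + t * e i)\<^sup>2) = 1 + 2 * t * u k + t\<^sup>2" .
      have "q (\<lambda>i. u i + t * e i) = (\<Sum>i<N. \<Sum>j<N. b i j * u i * u j + t * (e i * (b i j * u j))
          + t * (e j * (b i j * u i)) + t\<^sup>2 * (e i * (e j * b i j)))"
        unfolding q_def by (intro sum.cong refl) (simp add: power2_eq_square algebra_simps)
      also have "\<dots> = q u + t * (\<Sum>i<N. e i * (\<Sum>j<N. b i j * u j))
          + t * (\<Sum>i<N. \<Sum>j<N. e j * (b i j * u i)) + t\<^sup>2 * (\<Sum>i<N. e i * (\<Sum>j<N. e j * b i j))"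
        by (simp add: sum.distrib sum_distrib_left q_def)
      also have "\<dots> = q u + 2 * t * (\<Sum>j<N. b k j * u j) + t\<^sup>2 * b k k"
      proof -
        have "(\<Sum>i<N. b i k * u i) = (\<Sum>j<N. b k j * u j)"
          by (rule sum.cong[OF refl]) (simp only: sym[of k])
        then show ?thesis by (simp only: e1)
      qed
      finally show ?thesis
        using q_max[of "\<lambda>i. u i + t * e i"] n by (simp add: algebra_simps)
    qed
    then have "q u * u k - (\<Sum>j<N. b k j * u j) = 0" by (rule linear_coefficient_eq_0)
    then show ?thesis by simp
  qed
  moreover have "\<exists>i<N. u i \<noteq> 0"
  proof (rule ccontr)
    assume "\<not> (\<exists>i<N. u i \<noteq> 0)"
    then have "(\<Sum>i<N. (u i)\<^sup>2) = 0" by (intro sum.neutral) auto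
    with u1 show False by simp
  qed
  ultimately have "eigenvalue (mat N N (\<lambda>(i, j). b i j)) (q u)"
    unfolding eigenvalue_mat_iff by blast
  then show ?thesis
    using that q_max by (simp add: q_def)
qed

text \<open>\<Lambda> is the largest eigenvalue of K K^T, the squared norm of the N by S matrix K.
  The Rayleigh bound controls K^T, duality transfers it to K, and K^T applied to a top eigenvector
  is extremal for K. That vector has norm 0 when \<Lambda> = 0, hence the positivity assumption in
  the last claim.\<close>

lemma
  fixes K :: "nat \<Rightarrow> 'b \<Rightarrow> real" and S :: "'b set"
  assumes N: "N \<ge> 1"
  defines "\<Lambda> \<equiv> Max (spectrum (mat N N (\<lambda>(i, j). \<Sum>n\<in>S. K i n * K j n)))"
  shows gram_spectrum_bound_real:
      "(\<Sum>j<N. (\<Sum>n\<in>S. c n * K j n)\<^sup>2) \<le> \<Lambda> * (\<Sum>n\<in>S. (c n :: real)\<^sup>2)"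
    and gram_spectrum_bound:
      "(\<Sum>j<N. (cmod (\<Sum>n\<in>S. z n * of_real (K j n)))\<^sup>2) \<le> \<Lambda> * (\<Sum>n\<in>S. (cmod (z n))\<^sup>2)"
    and gram_spectrum_nonneg: "0 \<le> \<Lambda>"
    and gram_spectrum_attained: "\<Lambda> > 0 \<Longrightarrow> \<exists>c. (\<Sum>n\<in>S. (c n :: real)\<^sup>2) > 0 \<and>
       (\<Sum>j<N. (\<Sum>n\<in>S. c n * K j n)\<^sup>2) = \<Lambda> * (\<Sum>n\<in>S. (c n)\<^sup>2)"
proof -
  define b where "b = (\<lambda>i j. \<Sum>n\<in>S. K i n * K j n)"
  let ?B = "mat N N (\<lambda>(i, j). b i j)"
  have lm: "\<Lambda> = Max (spectrum ?B)" by (simp add: \<Lambda>_def b_def)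
  have fin: "finite (spectrum ?B)"
    by (rule card_finite_spectrum(1)[of _ N]) simp
  obtain \<mu> where mu: "eigenvalue ?B \<mu>"
      and max: "\<And>v. (\<Sum>i<N. \<Sum>j<N. b i j * v i * v j) \<le> \<mu> * (\<Sum>i<N. (v i)\<^sup>2)"
    by (rule rayleigh_max_eigenvalue[OF N, of b]) (auto simp: b_def mult.commute)
  have "\<mu> \<le> \<Lambda>"
    using fin mu by (auto simp: lm spectrum_def intro!: Max_ge)
  have quad: "(\<Sum>n\<in>S. (\<Sum>i<N. K i n * v i)\<^sup>2) = (\<Sum>i<N. \<Sum>j<N. b i j * v i * v j)" for v
  proof -
    have "(\<Sum>n\<in>S. (\<Sum>i<N. K i n * v i)\<^sup>2) = (\<Sum>n\<in>S. \<Sum>i<N. \<Sum>j<N. K i n * K j n * v i * v j)"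
      by (simp add: power2_eq_square sum_product mult_ac)
    also have "\<dots> = (\<Sum>i<N. \<Sum>j<N. \<Sum>n\<in>S. K i n * K j n * v i * v j)"
      by (subst sum.swap, intro sum.cong refl, subst sum.swap) (rule refl)
    finally show ?thesis by (simp add: b_def sum_distrib_right)
  qed
  have le: "(\<Sum>n\<in>S. (\<Sum>i<N. K i n * v i)\<^sup>2) \<le> \<Lambda> * (\<Sum>i<N. (v i)\<^sup>2)" for v
    unfolding quad using max[of v] mult_right_mono[OF \<open>\<mu> \<le> \<Lambda>\<close>, of "\<Sum>i<N. (v i)\<^sup>2"]
    by (simp add: sum_nonneg)
  \<comment> \<open>Test on the all-ones vector, whose squared norm N is positive.\<close>
  show nonneg: "0 \<le> \<Lambda>"
  proof -
    have "0 \<le> (\<Sum>n\<in>S. (\<Sum>i<N. K i n * 1)\<^sup>2)" by (intro sum_nonneg) simp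
    also have "\<dots> \<le> \<Lambda> * real N" using le[of "\<lambda>_. 1"] by simp
    finally show ?thesis using N by (simp add: zero_le_mult_iff)
  qed
  show bound: "(\<Sum>j<N. (\<Sum>n\<in>S. c n * K j n)\<^sup>2) \<le> \<Lambda> * (\<Sum>n\<in>S. (c n :: real)\<^sup>2)" for c
  proof -
    \<comment> \<open>With v = K c, V = |v|^2 is the inner product of c and K^T v. Cauchy-Schwarz
      and the bound for K^T give V^2 \<le> |c|^2 \<Lambda> V, and a factor V cancels.\<close>
    define v where "v = (\<lambda>j. \<Sum>n\<in>S. c n * K j n)"
    define V where "V = (\<Sum>j<N. (v j)\<^sup>2)"
    have "V = (\<Sum>j<N. \<Sum>n\<in>S. c n * K j n * v j)"
      by (simp add: V_def power2_eq_square v_def sum_distrib_right)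
    also have "\<dots> = (\<Sum>n\<in>S. c n * (\<Sum>j<N. K j n * v j))"
      by (subst sum.swap) (simp add: sum_distrib_left mult_ac)
    finally have "V\<^sup>2 = (\<Sum>n\<in>S. c n * (\<Sum>j<N. K j n * v j))\<^sup>2" by simp
    also have "\<dots> \<le> (\<Sum>n\<in>S. (c n)\<^sup>2) * (\<Sum>n\<in>S. (\<Sum>j<N. K j n * v j)\<^sup>2)"
      by (rule Cauchy_Schwarz_ineq_sum)
    also have "\<dots> \<le> (\<Sum>n\<in>S. (c n)\<^sup>2) * (\<Lambda> * V)"
      unfolding V_def by (intro mult_left_mono le sum_nonneg) simp
    finally have *: "V * V \<le> (\<Lambda> * (\<Sum>n\<in>S. (c n)\<^sup>2)) * V"
      by (simp add: power2_eq_square mult_ac)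
    have "V \<ge> 0" by (simp add: V_def sum_nonneg)
    moreover have "\<Lambda> * (\<Sum>n\<in>S. (c n)\<^sup>2) \<ge> 0" by (simp add: nonneg sum_nonneg)
    ultimately have "V \<le> \<Lambda> * (\<Sum>n\<in>S. (c n)\<^sup>2)"
      using * by (cases "V = 0") auto
    then show ?thesis by (simp add: V_def v_def)
  qed
  \<comment> \<open>K is real, so the real and imaginary parts of z are mapped separately and their
    squares add.\<close>
  show "(\<Sum>j<N. (cmod (\<Sum>n\<in>S. z n * of_real (K j n)))\<^sup>2) \<le> \<Lambda> * (\<Sum>n\<in>S. (cmod (z n))\<^sup>2)"
    using bound[of "\<lambda>n. Re (z n)"] bound[of "\<lambda>n. Im (z n)"]
    by (simp add: cmod_power2 sum.distrib distrib_left)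
  assume pos: "\<Lambda> > 0"
  have "\<Lambda> \<in> spectrum ?B"
    unfolding lm using fin mu by (intro Max_in) (auto simp: spectrum_def)
  then obtain v where v: "\<exists>i<N. v i \<noteq> 0" "\<forall>i<N. (\<Sum>j<N. b i j * v j) = \<Lambda> * v i"
    by (auto simp: spectrum_def eigenvalue_mat_iff)
  \<comment> \<open>c = K^T v for a top eigenvector v, so that K c = \<Lambda> v and |c|^2 =
    \<Lambda> |v|^2.\<close>
  define c where "c = (\<lambda>n. \<Sum>i<N. K i n * v i)"
  have vpos: "(\<Sum>i<N. (v i)\<^sup>2) > 0"
    using v(1) by (auto intro: sum_pos2)
  have c2: "(\<Sum>n\<in>S. (c n)\<^sup>2) = \<Lambda> * (\<Sum>i<N. (v i)\<^sup>2)"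
  proof -
    have "(\<Sum>n\<in>S. (c n)\<^sup>2) = (\<Sum>i<N. v i * (\<Sum>j<N. b i j * v j))"
      unfolding c_def quad by (simp add: sum_distrib_left mult_ac)
    also have "\<dots> = (\<Sum>i<N. v i * (\<Lambda> * v i))"
      using v(2) by (intro sum.cong) auto
    finally show ?thesis by (simp add: sum_distrib_left power2_eq_square mult_ac)
  qed
  have "(\<Sum>n\<in>S. c n * K j n) = \<Lambda> * v j" if "j < N" for j
  proof -
    have "(\<Sum>n\<in>S. c n * K j n) = (\<Sum>i<N. b j i * v i)"
      unfolding c_def b_def sum_distrib_right by (subst sum.swap) (simp add: mult_ac)
    then show ?thesis using v(2) that by simp
  qed
  then have "(\<Sum>j<N. (\<Sum>n\<in>S. c n * K j n)\<^sup>2) = (\<Sum>j<N. \<Lambda> * (\<Lambda> * (v j)\<^sup>2))"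
    by (intro sum.cong) (auto simp: power2_eq_square mult_ac)
  then have "(\<Sum>j<N. (\<Sum>n\<in>S. c n * K j n)\<^sup>2) = \<Lambda> * (\<Sum>n\<in>S. (c n)\<^sup>2)"
    by (simp only: c2 sum_distrib_left)
  then show "\<exists>c. (\<Sum>n\<in>S. (c n :: real)\<^sup>2) > 0 \<and>
       (\<Sum>j<N. (\<Sum>n\<in>S. c n * K j n)\<^sup>2) = \<Lambda> * (\<Sum>n\<in>S. (c n)\<^sup>2)"
    using pos vpos c2 by (intro exI[of _ c]) simp
qed

section \<open>Multi-indices and rearrangement of series\<close>

lemma multi_indices_0: "multi_indices 0 j = (if j = 0 then {\<lambda>_. undefined} else {})"
  by (auto simp: multi_indices_def)

lemma finite_multi_indices: "finite (multi_indices d j)"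
proof (rule finite_subset)
  show "multi_indices d j \<subseteq> {1..d} \<rightarrow>\<^sub>E {..j}"
    by (auto simp: multi_indices_def PiE_iff extensional_def intro: member_le_sum)
  show "finite ({1..d} \<rightarrow>\<^sub>E {..j})" by (intro finite_PiE) auto
qed

text \<open>Splitting off the last exponent k gives the induction step in the number of variables.
  Multi-indices are extensional, so the inverse map resets the last argument to
  \<open>undefined\<close>.\<close>

lemma sum_multi_indices_Suc:
  "(\<Sum>\<alpha>\<in>multi_indices (Suc d) j. f \<alpha>)
    = (\<Sum>k\<le>j. \<Sum>\<beta>\<in>multi_indices d (j - k). f (\<beta>(Suc d := k)))"
proof -
  have s: "(\<Sum>i = Suc 0..d. if i = Suc d then k else g i) = (\<Sum>i = Suc 0..d. g i)" for k and g :: "nat \<Rightarrow> nat"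
    by (rule sum.cong) auto
  have "(\<Sum>k\<le>j. \<Sum>\<beta>\<in>multi_indices d (j - k). f (\<beta>(Suc d := k)))
      = (\<Sum>(k, \<beta>)\<in>Sigma {..j} (\<lambda>k. multi_indices d (j - k)). f (\<beta>(Suc d := k)))"
    by (intro sum.Sigma) (auto simp: finite_multi_indices)
  also have "\<dots> = (\<Sum>\<alpha>\<in>multi_indices (Suc d) j. f \<alpha>)"
  proof (rule sum.reindex_bij_witness[where i = "\<lambda>\<alpha>. (\<alpha> (Suc d), \<alpha>(Suc d := undefined))"
        and j = "\<lambda>(k, \<beta>). \<beta>(Suc d := k)"])
    fix x assume "x \<in> Sigma {..j} (\<lambda>k. multi_indices d (j - k))"
    then obtain k \<beta> where x: "x = (k, \<beta>)" "k \<le> j" "\<beta> \<in> extensional {1..d}" "(\<Sum>i=1..d. \<beta> i) = j - k"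
      by (auto simp: multi_indices_def PiE_iff)
    then show "((case x of (k, \<beta>) \<Rightarrow> \<beta>(Suc d := k)) (Suc d), (case x of (k, \<beta>) \<Rightarrow> \<beta>(Suc d := k))(Suc d := undefined)) = x"
      by (auto simp: extensional_def)
    show "(case x of (k, \<beta>) \<Rightarrow> \<beta>(Suc d := k)) \<in> multi_indices (Suc d) j"
      using x by (auto simp: multi_indices_def PiE_iff extensional_def s)
    show "f (case x of (k, \<beta>) \<Rightarrow> \<beta>(Suc d := k)) = (case x of (k, \<beta>) \<Rightarrow> f (\<beta>(Suc d := k)))"
      by (simp add: x(1))
  next
    fix \<alpha> assume \<alpha>: "\<alpha> \<in> multi_indices (Suc d) j"
    then show "(\<alpha> (Suc d), \<alpha>(Suc d := undefined)) \<in> Sigma {..j} (\<lambda>k. multi_indices d (j - k))"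
      by (auto simp: multi_indices_def PiE_iff extensional_def s)
  qed auto
  finally show ?thesis by simp
qed

section \<open>Multinomial identities and the size of the row weights\<close>

lemma binomial_exp_form:
  fixes a b :: "'a :: field_char_0"
  shows "(a + b) ^ n / fact n = (\<Sum>k\<le>n. a ^ k / fact k * (b ^ (n - k) / fact (n - k)))"
  unfolding binomial_ring sum_divide_distrib
  by (intro sum.cong refl) (simp add: binomial_fact)

text \<open>Normalized by factorials because it serves twice: at x = r it bounds
  \<open>a_coeff\<close>, and at x_i = -r_i p_i^(-s) it identifies the degree-j block of the
  composed series with a multiple of z^j / j!.\<close>

lemma multinomial_exp_form:
  fixes x :: "nat \<Rightarrow> 'a :: field_char_0"
  shows "(\<Sum>\<alpha>\<in>multi_indices d j. \<Prod>i=1..d. x i ^ \<alpha> i / fact (\<alpha> i)) = (\<Sum>i=1..d. x i) ^ j / fact j"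
proof (induction d arbitrary: j)
  case 0
  then show ?case by (simp add: multi_indices_0)
next
  case (Suc d)
  have "(\<Sum>\<alpha>\<in>multi_indices (Suc d) j. \<Prod>i=1..Suc d. x i ^ \<alpha> i / fact (\<alpha> i))
      = (\<Sum>k\<le>j. x (Suc d) ^ k / fact k *
          (\<Sum>\<beta>\<in>multi_indices d (j - k). \<Prod>i=1..d. x i ^ \<beta> i / fact (\<beta> i)))"
    unfolding sum_multi_indices_Suc sum_distrib_left
    by (intro sum.cong refl) (auto simp: mult.commute intro!: prod.cong)
  also have "\<dots> = (x (Suc d) + (\<Sum>i=1..d. x i)) ^ j / fact j"
    by (simp only: Suc.IH binomial_exp_form)
  finally show ?case by (simp add: add.commute)
qed

lemma a_coeff_square:
  "(a_coeff d r j)\<^sup>2 = (\<Sum>\<alpha>\<in>multi_indices d j. (\<Prod>i=1..d. r i ^ \<alpha> i / fact (\<alpha> i))\<^sup>2)"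
proof -
  have "(a_coeff d r j)\<^sup>2
      = (\<Sum>\<alpha>\<in>multi_indices d j. (\<Prod>i=1..d. r i ^ (2 * \<alpha> i)) / (\<Prod>i=1..d. fact (\<alpha> i))\<^sup>2)"
    unfolding a_coeff_def by (intro real_sqrt_pow2 sum_nonneg) (simp add: prod_nonneg)
  then show ?thesis
    by (simp add: prod_dividef power_divide mult.commute[of 2] power_mult flip: prod_power_distrib)
qed

text \<open>For nonnegative terms the sum of squares is at most the square of the sum, and here that
  sum is multinomial.\<close>

lemma a_coeff_square_le:
  assumes "\<And>i. i \<in> {1..d} \<Longrightarrow> r i \<ge> 0"
  shows "(a_coeff d r j)\<^sup>2 \<le> ((\<Sum>i=1..d. r i) ^ j / fact j)\<^sup>2"
proof -
  define t where "t = (\<lambda>\<alpha>. \<Prod>i=1..d. r i ^ \<alpha> i / fact (\<alpha> i))"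
  have t: "t \<alpha> \<ge> 0" for \<alpha> using assms by (auto simp: t_def intro!: prod_nonneg)
  have "(\<Sum>\<alpha>\<in>multi_indices d j. (t \<alpha>)\<^sup>2) \<le> (\<Sum>\<alpha>\<in>multi_indices d j. t \<alpha> * (\<Sum>\<alpha>\<in>multi_indices d j. t \<alpha>))"
    unfolding power2_eq_square using t
    by (intro sum_mono mult_left_mono member_le_sum) (auto simp: finite_multi_indices)
  also have "\<dots> = (\<Sum>\<alpha>\<in>multi_indices d j. t \<alpha>)\<^sup>2"
    by (simp add: power2_eq_square sum_distrib_right)
  finally show ?thesis
    unfolding a_coeff_square t_def multinomial_exp_form .
qed

text \<open>The central binomial coefficient is one entry of a row with sum 2^(2j).\<close>

lemma central_binomial_le: "fact (2 * j) / (fact j)\<^sup>2 \<le> (4 ^ j :: real)"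
proof -
  have "(2 * j choose j) \<le> (\<Sum>k\<le>2 * j. (2 * j choose k))"
    by (intro member_le_sum) auto
  also have "\<dots> = 4 ^ j" by (simp add: choose_row_sum power_mult)
  finally have "real (2 * j choose j) \<le> 4 ^ j"
    by (metis of_nat_le_iff of_nat_numeral of_nat_power)
  then show ?thesis by (simp add: binomial_fact power2_eq_square)
qed

lemma a_coeff_square_fact_le:
  assumes "\<And>i. i \<in> {1..d} \<Longrightarrow> r i \<ge> 0" "\<epsilon> > 0"
  shows "(a_coeff d r j)\<^sup>2 * (fact (2 * j) / \<epsilon> ^ (2 * j)) \<le> (4 * (\<Sum>i=1..d. r i)\<^sup>2 / \<epsilon>\<^sup>2) ^ j"
proof -
  let ?R = "\<Sum>i=1..d. r i"
  have "(a_coeff d r j)\<^sup>2 * (fact (2 * j) / \<epsilon> ^ (2 * j)) \<le> (?R ^ j / fact j)\<^sup>2 * (fact (2 * j) / \<epsilon> ^ (2 * j))"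
    using assms by (intro mult_right_mono a_coeff_square_le) auto
  also have "\<dots> = (fact (2 * j) / (fact j)\<^sup>2) * (?R\<^sup>2 / \<epsilon>\<^sup>2) ^ j"
    by (simp add: power_divide flip: power_mult power_mult_distrib) (simp add: mult.commute)
  also have "\<dots> \<le> 4 ^ j * (?R\<^sup>2 / \<epsilon>\<^sup>2) ^ j"
    by (intro mult_right_mono central_binomial_le) auto
  finally show ?thesis by (simp flip: power_mult_distrib)
qed

text \<open>Fubini for iterated series, by way of unordered sums over pairs. The second conclusion
  keeps absolute convergence after the exchange, which the later regrouping by monomials
  requires.\<close>

lemma
  fixes u :: "nat \<Rightarrow> nat \<Rightarrow> 'a :: banach"
  assumes 1: "\<And>n. summable (\<lambda>j. norm (u n j))" and 2: "summable (\<lambda>n. \<Sum>j. norm (u n j))"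
  shows suminf_swap: "(\<Sum>n. \<Sum>j. u n j) = (\<Sum>j. \<Sum>n. u n j)"
    and summable_swap: "summable (\<lambda>j. \<Sum>n. norm (u n j))"
proof -
  have inf: "(\<Sum>\<^sub>\<infinity>n. v n) = (\<Sum>n. v n)" if "summable (\<lambda>n. norm (v n))" for v :: "nat \<Rightarrow> 'b :: banach"
    using norm_summable_imp_has_sum[OF that] that by (metis infsumI summable_norm_cancel summable_sums)
  have on: "f summable_on UNIV \<longleftrightarrow> summable f" if "\<And>n. f n \<ge> 0" for f :: "nat \<Rightarrow> real"
    using that by (rule summable_on_UNIV_nonneg_real_iff)
  have abs: "(\<lambda>x. norm (case x of (n, j) \<Rightarrow> u n j)) summable_on UNIV \<times> UNIV"
    by (rule Infinite_Sum.abs_summable_on_Sigma_iff[THEN iffD2])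
       (use 1 2 in \<open>simp add: on infsum_nonneg inf suminf_nonneg\<close>)
  then have abs': "(\<lambda>x. norm (case x of (j, n) \<Rightarrow> u n j)) summable_on UNIV \<times> UNIV"
    by (subst summable_on_reindex_bij_witness[where i = prod.swap and j = prod.swap]) auto
  have col: "summable (\<lambda>n. norm (u n j))" for j
    using Infinite_Sum.abs_summable_on_Sigma_iff[THEN iffD1, OF abs'] by (simp add: on)
  show cols: "summable (\<lambda>j. \<Sum>n. norm (u n j))"
    using Infinite_Sum.abs_summable_on_Sigma_iff[THEN iffD1, OF abs'] col
    by (simp add: on infsum_nonneg inf suminf_nonneg)
  have "(\<lambda>(n, j). u n j) summable_on UNIV \<times> UNIV"
    by (rule abs_summable_summable[OF abs])
  then have "(\<Sum>\<^sub>\<infinity>n. \<Sum>\<^sub>\<infinity>j. u n j) = (\<Sum>\<^sub>\<infinity>j. \<Sum>\<^sub>\<infinity>n. u n j)"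
    by (rule infsum_swap_banach)
  moreover have "summable (\<lambda>n. norm (\<Sum>j. u n j))"
    by (rule summable_comparison_test'[OF 2]) (simp add: summable_norm 1)
  moreover have "summable (\<lambda>j. norm (\<Sum>n. u n j))"
    by (rule summable_comparison_test'[OF cols]) (simp add: summable_norm col)
  ultimately show "(\<Sum>n. \<Sum>j. u n j) = (\<Sum>j. \<Sum>n. u n j)"
    by (simp add: inf 1 col)
qed

lemma sums_regroup:
  fixes g :: "'i \<Rightarrow> 'a :: banach" and I :: "nat \<Rightarrow> 'i set" and e :: "'i \<Rightarrow> nat"
  defines "U \<equiv> \<Union>j. I j"
  assumes fin: "\<And>j. finite (I j)" and disj: "disjoint_family I" and inj: "inj_on e U"
    and sm: "summable (\<lambda>j. \<Sum>i\<in>I j. norm (g i))"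
  shows "(\<lambda>m. if m \<in> e ` U then g (inv_into U e m) else 0) sums (\<Sum>j. \<Sum>i\<in>I j. g i)"
proof -
  have abs: "(\<lambda>x. norm (case x of (j :: nat, i) \<Rightarrow> g i)) summable_on Sigma UNIV I"
    by (rule Infinite_Sum.abs_summable_on_Sigma_iff[THEN iffD2]) (use sm fin in \<open>
      simp add: summable_on_UNIV_nonneg_real_iff sum_nonneg\<close>)
  define S where "S = infsum (\<lambda>(j, i). g i) (Sigma UNIV I)"
  have S: "((\<lambda>(j, i). g i) has_sum S) (Sigma UNIV I)"
    unfolding S_def by (intro has_sum_infsum abs_summable_summable[OF abs])
  then have "((\<lambda>j. \<Sum>i\<in>I j. g i) has_sum S) UNIV"
    by (rule has_sum_SigmaD) (simp add: fin has_sum_finite)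
  then have S_eq: "S = (\<Sum>j. \<Sum>i\<in>I j. g i)"
    by (intro sums_unique has_sum_imp_sums)
  \<comment> \<open>The blocks are disjoint, so forgetting the block number is injective.\<close>
  have bij: "bij_betw snd (Sigma UNIV I) U"
    using disj by (fastforce simp: bij_betw_def inj_on_def U_def disjoint_family_on_def image_iff)
  have "(g has_sum S) U"
    using S has_sum_reindex_bij_betw[OF bij, of g S] by (simp add: case_prod_unfold)
  then have "((\<lambda>m. g (inv_into U e m)) has_sum S) (e ` U)"
    using has_sum_reindex_bij_betw[OF bij_betw_inv_into[OF inj_on_imp_bij_betw[OF inj]], of g S] by simp
  then have "((\<lambda>m. if m \<in> e ` U then g (inv_into U e m) else 0) has_sum S) UNIV"
    by (subst (asm) has_sum_cong_neutral[of UNIV _ "\<lambda>m. if m \<in> e ` U then g (inv_into U e m) else 0"]) auto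
  then show ?thesis
    unfolding S_eq by (rule has_sum_imp_sums)
qed

section \<open>Dirichlet series\<close>

lemma summable_coeff_hd: "summable (\<lambda>n. (cmod (coeff_hd f n))\<^sup>2)"
  using coeff_hd[of f] by simp

lemma coeff_hd_0 [simp]: "coeff_hd f 0 = 0"
  using coeff_hd[of f] by simp

lemma norm_hd_square: "(norm f)\<^sup>2 = (\<Sum>n. (cmod (coeff_hd f n))\<^sup>2)"
  unfolding norm_hardy_dirichlet_def
  by (intro real_sqrt_pow2 suminf_nonneg summable_coeff_hd) simp

text \<open>Cauchy-Schwarz against n^(-x), which is square-summable because 2x > 1.\<close>

lemma summable_coeff_hd_powr:
  assumes "x > 1 / 2"
  shows "summable (\<lambda>n. cmod (coeff_hd f n) * real n powr - x)"
proof -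
  have "(real n powr - x)\<^sup>2 = real n powr - (2 * x)" for n
    by (simp add: power2_eq_square flip: powr_add)
  then have "summable (\<lambda>n. (real n powr - x)\<^sup>2)"
    using summable_powr_minus[of "2 * x"] assms by simp
  then show ?thesis
    using Cauchy_Schwarz_suminf(1)[OF summable_coeff_hd[of f], of "\<lambda>n. real n powr - x"] by simp
qed

lemma norm_of_nat_powr: "cmod (of_nat n powr s) = real n powr Re s"
  by (simp add: norm_powr_real_powr)

lemma eval_hd_of_nat:
  assumes "k > 0"
  shows "eval_hd f (of_nat k) = (\<Sum>n. coeff_hd f n * inverse (of_nat n) ^ k)"
proof -
  have "coeff_hd f n * of_nat n powr (- of_nat k) = coeff_hd f n * inverse (of_nat n) ^ k" for n
    by (cases "n = 0") (simp_all add: powr_minus power_inverse)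
  then show ?thesis by (simp only: eval_hd_def)
qed

text \<open>
  As \<open>s \<rightarrow> \<infinity>\<close> along the integers, the first nonvanishing term dominates the series.
\<close>

lemma dirichlet_series_coeff_eq_0:
  fixes c :: "nat \<Rightarrow> complex"
  assumes c0: "c 0 = 0" and sm: "summable (\<lambda>n. cmod (c n) * inverse (real n) ^ 2)"
    and zero: "\<And>k. k \<ge> 2 \<Longrightarrow> (\<Sum>n. c n * inverse (of_nat n) ^ k) = 0"
  shows "c n = 0"
proof (induction n rule: less_induct)
  case (less m)
  show ?case
  proof (cases "m = 0")
    case False
    define K where "K = (\<Sum>n. cmod (c n) * inverse (real n) ^ 2)"
    define \<rho> where "\<rho> = real m / real (Suc m)"
    have \<rho>: "0 \<le> \<rho>" "\<rho> < 1" using False by (auto simp: \<rho>_def)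
    \<comment> \<open>Isolating term m of the vanishing series at exponent k + 2 gives |c m|
      m^(-(k+2)) \<le> K (m+1)^(-k). Two of the powers keep the remainder summable; the other k
      produce the decay \<rho>^k that forces c m = 0.\<close>
    have bound: "cmod (c m) \<le> K * real m ^ 2 * \<rho> ^ k" for k
    proof -
      define t where "t = (\<lambda>n. c n * inverse (of_nat n) ^ (k + 2))"
      have le: "cmod (t n) \<le> cmod (c n) * inverse (real n) ^ 2" for n
      proof (cases "n = 0")
        case False
        then have "inverse (real n) ^ (k + 2) \<le> inverse (real n) ^ 2"
          by (intro power_decreasing) (auto simp: inverse_le_1_iff)
        then show ?thesis
          unfolding t_def norm_mult norm_power norm_inverse norm_of_nat
          by (rule mult_left_mono) simp
      qed (simp add: t_def c0)
      have smt: "summable (\<lambda>n. cmod (t n))"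
        by (rule summable_comparison_test'[OF sm]) (simp add: le)
      have "suminf t = 0" using zero[of "k + 2"] by (simp add: t_def)
      moreover have "(\<Sum>n<Suc m. t n) = t m"
        using less.IH by (simp add: t_def)
      ultimately have tm: "t m = - (\<Sum>n. t (n + Suc m))"
        using suminf_split_initial_segment[OF summable_norm_cancel[OF smt], of "Suc m"]
        by (simp add: eq_neg_iff_add_eq_0 add.commute)
      have tail: "cmod (t (n + Suc m)) \<le>
          cmod (c (n + Suc m)) * inverse (real (n + Suc m)) ^ 2 * inverse (real (Suc m)) ^ k" for n
        unfolding t_def norm_mult norm_power norm_inverse norm_of_nat power_add
        by (auto simp: mult_ac intro!: mult_left_mono power_mono le_imp_inverse_le)
      have smK: "summable (\<lambda>n. cmod (c (n + Suc m)) * inverse (real (n + Suc m)) ^ 2)"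
        by (rule summable_ignore_initial_segment[OF sm])
      have "cmod (t m) \<le> (\<Sum>n. cmod (t (n + Suc m)))"
        unfolding tm norm_minus_cancel
        by (rule summable_norm[OF summable_ignore_initial_segment[OF smt]])
      also have "\<dots> \<le> (\<Sum>n. cmod (c (n + Suc m)) * inverse (real (n + Suc m)) ^ 2 * inverse (real (Suc m)) ^ k)"
        by (intro suminf_le tail summable_mult2 smK summable_ignore_initial_segment[OF smt])
      also have "\<dots> = (\<Sum>n. cmod (c (n + Suc m)) * inverse (real (n + Suc m)) ^ 2) * inverse (real (Suc m)) ^ k"
        by (rule suminf_mult2[OF smK, symmetric])
      also have "\<dots> \<le> K * inverse (real (Suc m)) ^ k"
        unfolding K_def suminf_split_initial_segment[OF sm, of "Suc m"]
        by (intro mult_right_mono) (auto intro!: sum_nonneg add_nonneg_nonneg)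
      finally have "cmod (c m) * inverse (real m) ^ (k + 2) \<le> K * inverse (real (Suc m)) ^ k"
        by (simp add: t_def norm_mult norm_power norm_inverse)
      then have "cmod (c m) * inverse (real m) ^ (k + 2) * real m ^ (k + 2)
          \<le> K * inverse (real (Suc m)) ^ k * real m ^ (k + 2)"
        by (rule mult_right_mono) simp
      moreover have "inverse (real m) ^ (k + 2) * real m ^ (k + 2) = 1"
        using False by (simp only: power_mult_distrib[symmetric]) simp
      moreover have "inverse (real (Suc m)) ^ k * real m ^ (k + 2) = real m ^ 2 * \<rho> ^ k"
        unfolding \<rho>_def power_divide power_add divide_inverse
        by (simp add: mult_ac power_mult_distrib power_inverse)
      ultimately show ?thesis
        by (simp only: mult.assoc mult_1_right)
    qed
    have "(\<lambda>k. K * real m ^ 2 * \<rho> ^ k) \<longlonglongrightarrow> K * real m ^ 2 * 0"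
      using \<rho> by (intro tendsto_mult tendsto_const LIMSEQ_power_zero) simp
    then have "cmod (c m) \<le> K * real m ^ 2 * 0"
      by (rule LIMSEQ_le_const) (use bound in blast)
    then show ?thesis by simp
  qed (simp add: c0)
qed

text \<open>Supplies the uniqueness behind the \<open>THE\<close> in \<open>composition_hd\<close>.
  The integer points k \<ge> 2 lie in the half-plane and already determine the coefficients.\<close>

lemma eval_hd_inject:
  assumes "\<And>s. Re s > 1 / 2 \<Longrightarrow> eval_hd f s = eval_hd g s"
  shows "f = g"
proof -
  have sm: "summable (\<lambda>n. cmod (coeff_hd f n) * inverse (real n) ^ 2)" for f
  proof -
    have "cmod (coeff_hd f n) * real n powr - 2 = cmod (coeff_hd f n) * inverse (real n) ^ 2" for n
      by (cases "n = 0") (simp_all add: powr_minus power_inverse)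
    then show ?thesis using summable_coeff_hd_powr[of 2 f] by (simp only:)
  qed
  have smk: "summable (\<lambda>n. coeff_hd f n * inverse (of_nat n) ^ k)" if "k \<ge> 2" for f k
  proof (rule summable_comparison_test'[OF sm[of f]])
    fix n
    have "inverse (real n) ^ k \<le> inverse (real n) ^ 2" if "n > 0"
      using that \<open>k \<ge> 2\<close> by (intro power_decreasing) (auto simp: inverse_le_1_iff)
    then show "norm (coeff_hd f n * inverse (of_nat n) ^ k) \<le> cmod (coeff_hd f n) * inverse (real n) ^ 2"
      by (cases "n = 0") (auto simp: norm_mult norm_power norm_inverse mult_left_mono)
  qed
  have "coeff_hd f n - coeff_hd g n = 0" for n
  proof (rule dirichlet_series_coeff_eq_0[where c = "\<lambda>n. coeff_hd f n - coeff_hd g n"])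
    show "summable (\<lambda>n. cmod (coeff_hd f n - coeff_hd g n) * inverse (real n) ^ 2)"
      by (rule summable_comparison_test'[OF summable_add[OF sm[of f] sm[of g]]])
         (auto simp: norm_triangle_ineq4 mult_right_mono simp flip: distrib_right)
    show "(\<Sum>n. (coeff_hd f n - coeff_hd g n) * inverse (of_nat n) ^ k) = 0" if "k \<ge> 2" for k
      using assms[of "of_nat k"] that smk[OF that, of f] smk[OF that, of g]
      by (simp add: eval_hd_of_nat left_diff_distrib flip: suminf_diff)
  qed simp
  then show ?thesis
    by (simp add: coeff_hd_inject[symmetric] fun_eq_iff)
qed

section \<open>The composition operator\<close>

text \<open>Up to the factor (-1)^j this is the j-th derivative of f at \<sigma>.\<close>

definition log_functional :: "real \<Rightarrow> hardy_dirichlet \<Rightarrow> nat \<Rightarrow> complex" where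
  "log_functional \<sigma> f j = (\<Sum>n. coeff_hd f n * of_real (log_weight \<sigma> j n))"

text \<open>Generic in the field because it is applied both at the complex number z and, for
  absolute convergence, at the real number |z|.\<close>

lemma log_weight_exp_sums:
  fixes z :: "'a :: {real_normed_field, banach}"
  shows "(\<lambda>j. of_real (log_weight \<sigma> j n) * (z ^ j / fact j))
    sums (of_real (real n powr - \<sigma>) * exp (of_real (ln (real n)) * z))"
proof -
  have "(\<lambda>j. of_real (real n powr - \<sigma>) * ((of_real (ln (real n)) * z) ^ j /\<^sub>R fact j))
      sums (of_real (real n powr - \<sigma>) * exp (of_real (ln (real n)) * z))"
    by (intro sums_mult exp_converges)
  moreover have "of_real (real n powr - \<sigma>) * ((of_real (ln (real n)) * z) ^ j /\<^sub>R fact j)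
      = of_real (log_weight \<sigma> j n) * (z ^ j / fact j)" for j
    by (simp add: log_weight_def power_mult_distrib scaleR_conv_of_real divide_inverse mult_ac)
  ultimately show ?thesis by simp
qed

text \<open>Taylor expansion at \<sigma>; the displacement -z absorbs the signs (-1)^j. The sums
  over n and j may be exchanged because the absolute double sum is that of |a_n| n^(-(\<sigma> -
  |z|)), and \<sigma> - |z| > 1/2.\<close>

lemma
  fixes z :: complex
  assumes z: "cmod z < \<sigma> - 1 / 2"
  shows eval_hd_expansion: "eval_hd f (of_real \<sigma> - z) = (\<Sum>j. log_functional \<sigma> f j * (z ^ j / fact j))"
    and summable_log_functional_exp: "summable (\<lambda>j. cmod (log_functional \<sigma> f j) * (cmod z ^ j / fact j))"
proof -
  define u where "u = (\<lambda>n j. coeff_hd f n * (of_real (log_weight \<sigma> j n) * (z ^ j / fact j)))"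
  have nu: "(\<lambda>j. cmod (u n j)) sums (cmod (coeff_hd f n) * real n powr - (\<sigma> - cmod z))" for n
  proof (cases "n = 0")
    case False
    have "real n powr - \<sigma> * exp (ln (real n) * cmod z) = real n powr - (\<sigma> - cmod z)"
      using False by (simp add: powr_def algebra_simps flip: exp_add)
    then show ?thesis
      using sums_mult[OF log_weight_exp_sums[of \<sigma> n "cmod z"], of "cmod (coeff_hd f n)"]
      by (simp add: u_def norm_mult norm_divide norm_power)
  qed (simp add: u_def)
  have 1: "summable (\<lambda>j. cmod (u n j))" for n
    using nu by (rule sums_summable)
  have 2: "summable (\<lambda>n. \<Sum>j. cmod (u n j))"
    using summable_coeff_hd_powr[of "\<sigma> - cmod z" f] z by (simp add: sums_unique[OF nu, symmetric])
  have "(\<Sum>j. u n j) = coeff_hd f n * of_nat n powr - (of_real \<sigma> - z)" for n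
  proof (cases "n = 0")
    case False
    then have "of_nat n powr - (of_real \<sigma> - z)
        = of_real (real n powr - \<sigma>) * exp (of_real (ln (real n)) * z)"
      by (simp add: powr_def algebra_simps Ln_of_nat exp_of_real[symmetric] flip: exp_add)
    then show ?thesis
      using sums_unique[OF sums_mult[OF log_weight_exp_sums[of \<sigma> n z], of "coeff_hd f n"]]
      by (simp add: u_def)
  qed (simp add: u_def)
  then have "eval_hd f (of_real \<sigma> - z) = (\<Sum>n. \<Sum>j. u n j)"
    by (simp add: eval_hd_def)
  also have "\<dots> = (\<Sum>j. \<Sum>n. u n j)"
    by (rule suminf_swap[OF 1 2])
  finally have swap: "eval_hd f (of_real \<sigma> - z) = (\<Sum>j. \<Sum>n. u n j)" .
  \<comment> \<open>The value (2\<sigma> - 1)/2 serves as an \<epsilon> strictly between 0 and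
    2\<sigma> - 1; this interval is nonempty since 0 \<le> |z| < \<sigma> - 1/2.\<close>
  have smw: "summable (\<lambda>n. cmod (coeff_hd f n) * log_weight \<sigma> j n)" for j
    using Cauchy_Schwarz_suminf(1)[OF summable_coeff_hd[of f], of "log_weight \<sigma> j"]
      summable_log_weight_square[of "(2 * \<sigma> - 1) / 2" \<sigma> j] z norm_ge_zero[of z] by simp
  have nL: "(\<Sum>n. cmod (u n j)) = (\<Sum>n. cmod (coeff_hd f n) * log_weight \<sigma> j n) * (cmod z ^ j / fact j)" for j
    using suminf_mult2[OF smw, of j "cmod z ^ j / fact j"]
    by (simp add: u_def norm_mult norm_divide norm_power mult.assoc)
  have smc: "summable (\<lambda>n. coeff_hd f n * of_real (log_weight \<sigma> j n))" for j
    by (rule summable_norm_cancel) (simp add: norm_mult smw)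
  have "(\<Sum>n. u n j) = log_functional \<sigma> f j * (z ^ j / fact j)" for j
    using suminf_mult2[OF smc, of j "z ^ j / fact j"]
    by (simp add: u_def log_functional_def mult.assoc)
  with swap show "eval_hd f (of_real \<sigma> - z) = (\<Sum>j. log_functional \<sigma> f j * (z ^ j / fact j))"
    by simp
  have "cmod (log_functional \<sigma> f j) \<le> (\<Sum>n. cmod (coeff_hd f n) * log_weight \<sigma> j n)" for j
    using summable_norm[of "\<lambda>n. coeff_hd f n * of_real (log_weight \<sigma> j n)"] smw[of j]
    by (simp add: log_functional_def norm_mult)
  then have "cmod (log_functional \<sigma> f j) * (cmod z ^ j / fact j) \<le> (\<Sum>n. cmod (u n j))" for j
    unfolding nL by (rule mult_right_mono) simp
  then show "summable (\<lambda>j. cmod (log_functional \<sigma> f j) * (cmod z ^ j / fact j))"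
    by (intro summable_comparison_test'[OF summable_swap[OF 1 2]]) simp
qed

section \<open>Multi-indices as exponents of products of primes\<close>

lemma disjoint_family_multi_indices: "disjoint_family (multi_indices d)"
  by (auto simp: disjoint_family_on_def multi_indices_def)

text \<open>Complex \<open>powr\<close> is not multiplicative in general; here the bases are
  positive integers, so no branch of the logarithm interferes.\<close>

lemma of_nat_prod_power_powr:
  "of_nat (\<Prod>i\<in>A. n i ^ k i) powr s = (\<Prod>i\<in>A. (of_nat (n i) powr s :: complex) ^ k i)"
    if "\<And>i. i \<in> A \<Longrightarrow> n i > 0" for n k :: "'i \<Rightarrow> nat"
proof -
  have pow: "of_nat (m ^ l) powr s = (of_nat m powr s :: complex) ^ l" if "m > 0" for m l :: nat
    by (induction l) (simp_all add: powr_times_real)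
  have mult: "of_nat (l * m) powr s = (of_nat l powr s * of_nat m powr s :: complex)" for l m :: nat
    by (simp add: powr_times_real)
  show ?thesis
    using that
    by (induction A rule: infinite_finite_induct)
       (simp_all add: mult pow del: of_nat_power of_nat_mult of_nat_prod)
qed

locale dirichlet_polynomial_symbol =
  fixes d :: nat and p :: "nat \<Rightarrow> nat" and r :: "nat \<Rightarrow> real" and \<sigma> :: real
  assumes prime_p: "i \<in> {1..d} \<Longrightarrow> prime (p i)"
    and inj_p: "inj_on p {1..d}"
    and r_nonneg: "i \<in> {1..d} \<Longrightarrow> r i \<ge> 0"
    and sum_r_less: "(\<Sum>i=1..d. r i) < \<sigma> - 1 / 2"
begin

definition symbol :: "complex \<Rightarrow> complex" where
  "symbol s = of_real \<sigma> + (\<Sum>i=1..d. of_real (r i) * of_nat (p i) powr (- s))"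

definition monomial_nat :: "(nat \<Rightarrow> nat) \<Rightarrow> nat" where
  "monomial_nat \<alpha> = (\<Prod>i=1..d. p i ^ \<alpha> i)"

definition comp_term :: "hardy_dirichlet \<Rightarrow> (nat \<Rightarrow> nat) \<Rightarrow> complex" where
  "comp_term f \<alpha> = (\<Prod>i=1..d. of_real (- r i) ^ \<alpha> i / fact (\<alpha> i)) * log_functional \<sigma> f (\<Sum>i=1..d. \<alpha> i)"

lemma sum_r_nonneg: "(\<Sum>i=1..d. r i) \<ge> 0"
  by (intro sum_nonneg r_nonneg)

lemma monomial_nat_pos: "monomial_nat \<alpha> > 0"
  unfolding monomial_nat_def by (intro prod_pos) (simp add: prime_p prime_gt_0_nat)

text \<open>The primes are distinct, so the product can be reindexed by the primes themselves, the
  form in which unique factorization reads off exponents.\<close>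

lemma multiplicity_monomial_nat:
  assumes i: "i \<in> {1..d}"
  shows "multiplicity (p i) (monomial_nat \<alpha>) = \<alpha> i"
proof -
  have "monomial_nat \<alpha> = (\<Prod>q\<in>p ` {1..d}. q ^ \<alpha> (inv_into {1..d} p q))"
    unfolding monomial_nat_def using inj_p by (simp add: prod.reindex)
  moreover have "multiplicity (p i) (\<Prod>q\<in>p ` {1..d}. q ^ \<alpha> (inv_into {1..d} p q))
      = (if p i \<in> p ` {1..d} then \<alpha> (inv_into {1..d} p (p i)) else 0)"
    by (rule multiplicity_prod_prime_powers) (use prime_p i in auto)
  ultimately show ?thesis using i inj_p by simp
qed

lemma inj_on_monomial_nat: "inj_on monomial_nat (\<Union>j. multi_indices d j)"
proof (rule inj_onI)
  fix \<alpha> \<beta> assume *: "\<alpha> \<in> (\<Union>j. multi_indices d j)" "\<beta> \<in> (\<Union>j. multi_indices d j)"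
    and eq: "monomial_nat \<alpha> = monomial_nat \<beta>"
  have "\<alpha> i = \<beta> i" if "i \<in> {1..d}" for i
    using multiplicity_monomial_nat[OF that, of \<alpha>] multiplicity_monomial_nat[OF that, of \<beta>] eq by simp
  with * show "\<alpha> = \<beta>"
    by (intro PiE_ext[of _ "{1..d}" "\<lambda>_. UNIV"]) (auto simp: multi_indices_def)
qed

lemma sum_norm_comp_term_square:
  "(\<Sum>\<alpha>\<in>multi_indices d j. (cmod (comp_term f \<alpha>))\<^sup>2) = (a_coeff d r j)\<^sup>2 * (cmod (log_functional \<sigma> f j))\<^sup>2"
  unfolding a_coeff_square sum_distrib_right
  by (intro sum.cong refl) (auto simp: comp_term_def norm_mult power_mult_distrib multi_indices_def
      prod_norm[symmetric] norm_divide norm_power r_nonneg intro!: prod.cong)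

text \<open>The Taylor series at z = R converges absolutely, so its terms x_j tend to 0 and
  eventually x_j^2 \<le> x_j. By a_j \<le> R^j / j! the squares x_j^2 dominate the terms in
  question.\<close>

lemma summable_a_coeff_log_functional:
  "summable (\<lambda>j. (a_coeff d r j)\<^sup>2 * (cmod (log_functional \<sigma> f j))\<^sup>2)"
proof -
  let ?R = "\<Sum>i=1..d. r i"
  define x where "x = (\<lambda>j. cmod (log_functional \<sigma> f j) * (?R ^ j / fact j))"
  have "cmod (of_real ?R) = ?R"
    using sum_r_nonneg by (simp only: norm_of_real abs_of_nonneg)
  then have sm: "summable x"
    using summable_log_functional_exp[of "of_real ?R" \<sigma> f] sum_r_less by (simp only: x_def)
  have x: "x j \<ge> 0" for j using sum_r_nonneg by (simp add: x_def)
  have "eventually (\<lambda>j. x j < 1) sequentially"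
    using summable_LIMSEQ_zero[OF sm] by (rule order_tendstoD) simp
  then have "eventually (\<lambda>j. norm ((a_coeff d r j)\<^sup>2 * (cmod (log_functional \<sigma> f j))\<^sup>2) \<le> x j) sequentially"
  proof eventually_elim
    case (elim j)
    have "(a_coeff d r j)\<^sup>2 * (cmod (log_functional \<sigma> f j))\<^sup>2
        \<le> (?R ^ j / fact j)\<^sup>2 * (cmod (log_functional \<sigma> f j))\<^sup>2"
      by (intro mult_right_mono a_coeff_square_le r_nonneg) auto
    also have "\<dots> = x j * x j" by (simp add: x_def power2_eq_square mult_ac)
    also have "\<dots> \<le> x j" using elim x[of j] by (simp add: mult_left_le)
    finally show ?case by simp
  qed
  then show ?thesis using sm by (rule summable_comparison_test_ev)
qed

text \<open>The witness carries \<open>comp_term f \<alpha>\<close> at the integer p^\<alpha>.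
  Regrouping is applied twice: to squared moduli, for membership in the space and the norm, and to
  the terms at each s, for the values.\<close>

lemma composition_exists:
  obtains g where "\<And>s. Re s > 1 / 2 \<Longrightarrow> eval_hd g s = eval_hd f (symbol s)"
    "(norm g)\<^sup>2 = (\<Sum>j. (a_coeff d r j)\<^sup>2 * (cmod (log_functional \<sigma> f j))\<^sup>2)"
proof -
  define U where "U = (\<Union>j. multi_indices d j)"
  define b where "b = (\<lambda>m. if m \<in> monomial_nat ` U
    then comp_term f (inv_into U monomial_nat m) else 0)"
  note regroup = sums_regroup[of "multi_indices d" monomial_nat, folded U_def, OF finite_multi_indices
      disjoint_family_multi_indices inj_on_monomial_nat[folded U_def]]
  have "(\<lambda>m. if m \<in> monomial_nat ` U then (cmod (comp_term f (inv_into U monomial_nat m)))\<^sup>2 else 0)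
      sums (\<Sum>j. \<Sum>\<alpha>\<in>multi_indices d j. (cmod (comp_term f \<alpha>))\<^sup>2)"
    by (rule regroup) (simp add: sum_norm_comp_term_square summable_a_coeff_log_functional)
  then have b2: "(\<lambda>m. (cmod (b m))\<^sup>2) sums (\<Sum>j. (a_coeff d r j)\<^sup>2 * (cmod (log_functional \<sigma> f j))\<^sup>2)"
    by (simp add: b_def sum_norm_comp_term_square if_distrib[of "\<lambda>x. (cmod x)\<^sup>2"] cong: if_cong)
  \<comment> \<open>The type demands the value 0 at index 0, which holds since products of prime
    powers are positive.\<close>
  have "0 \<notin> monomial_nat ` U"
    using monomial_nat_pos by (metis imageE less_irrefl)
  then have "b 0 = 0" by (simp add: b_def)
  then have g: "coeff_hd (Abs_hardy_dirichlet b) = b"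
    using sums_summable[OF b2] by (intro Abs_hardy_dirichlet_inverse) simp
  show ?thesis
  proof (rule that)
    show "(norm (Abs_hardy_dirichlet b))\<^sup>2 = (\<Sum>j. (a_coeff d r j)\<^sup>2 * (cmod (log_functional \<sigma> f j))\<^sup>2)"
      unfolding norm_hd_square g by (rule sums_unique[OF b2, symmetric])
    fix s :: complex assume s: "Re s > 1 / 2"
    \<comment> \<open>The minus sign brings \<open>symbol s\<close> into the form \<sigma> - z of
      the Taylor expansion. x is the same sum in absolute values, so its powers give the absolute
      sums of the blocks.\<close>
    define z where "z = (\<Sum>i=1..d. of_real (- r i) * of_nat (p i) powr (- s))"
    define x where "x = (\<Sum>i=1..d. r i * real (p i) powr (- Re s))"
    have "x \<le> (\<Sum>i=1..d. r i)"
      unfolding x_def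
    proof (intro sum_mono mult_left_le r_nonneg)
      fix i assume "i \<in> {1..d}"
      then have "real (p i) \<ge> 1" using prime_p[of i] prime_ge_1_nat[of "p i"] by simp
      then show "real (p i) powr (- Re s) \<le> 1"
        using powr_mono[of "- Re s" 0 "real (p i)"] s by simp
    qed
    then have x_less: "x < \<sigma> - 1 / 2" using sum_r_less by simp
    have x_nonneg: "x \<ge> 0" unfolding x_def by (intro sum_nonneg mult_nonneg_nonneg r_nonneg) auto
    have "cmod z \<le> x"
      unfolding z_def x_def
      by (rule order_trans[OF norm_sum]) (simp add: norm_mult norm_of_nat_powr r_nonneg)
    then have z_less: "cmod z < \<sigma> - 1 / 2" using x_less by simp
    have symbol_eq: "symbol s = of_real \<sigma> - z"
      by (simp add: symbol_def z_def sum_negf)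
    have mono: "of_nat (monomial_nat \<alpha>) powr (- s) = (\<Prod>i=1..d. (of_nat (p i) powr (- s)) ^ \<alpha> i)" for \<alpha>
      unfolding monomial_nat_def by (rule of_nat_prod_power_powr) (simp add: prime_p prime_gt_0_nat)
    have term_eq: "comp_term f \<alpha> * of_nat (monomial_nat \<alpha>) powr (- s)
        = (\<Prod>i=1..d. (of_real (- r i) * of_nat (p i) powr (- s)) ^ \<alpha> i / fact (\<alpha> i)) * log_functional \<sigma> f j"
      if "\<alpha> \<in> multi_indices d j" for \<alpha> j
      using that unfolding comp_term_def mono
      by (simp add: multi_indices_def power_mult_distrib prod.distrib prod_dividef
          del: of_real_minus mult_minus_left)
    have group: "(\<Sum>\<alpha>\<in>multi_indices d j. comp_term f \<alpha> * of_nat (monomial_nat \<alpha>) powr (- s))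
        = log_functional \<sigma> f j * (z ^ j / fact j)" for j
      unfolding z_def multinomial_exp_form[symmetric] sum_distrib_left
      by (intro sum.cong refl) (simp add: term_eq mult.commute)
    have group_norm: "(\<Sum>\<alpha>\<in>multi_indices d j. cmod (comp_term f \<alpha> * of_nat (monomial_nat \<alpha>) powr (- s)))
        = cmod (log_functional \<sigma> f j) * (x ^ j / fact j)" for j
      unfolding x_def multinomial_exp_form[symmetric] sum_distrib_left
      by (intro sum.cong refl) (auto simp: term_eq norm_mult prod_norm[symmetric] norm_divide norm_power
          norm_of_nat_powr r_nonneg mult.commute intro!: prod.cong)
    have "(\<lambda>m. if m \<in> monomial_nat ` U then comp_term f (inv_into U monomial_nat m) *
          of_nat (monomial_nat (inv_into U monomial_nat m)) powr (- s) else 0)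
        sums (\<Sum>j. \<Sum>\<alpha>\<in>multi_indices d j. comp_term f \<alpha> * of_nat (monomial_nat \<alpha>) powr (- s))"
    proof (rule regroup)
      show "summable (\<lambda>j. \<Sum>\<alpha>\<in>multi_indices d j. cmod (comp_term f \<alpha> * of_nat (monomial_nat \<alpha>) powr (- s)))"
        using summable_log_functional_exp[of "of_real x" \<sigma> f] x_less x_nonneg by (simp add: group_norm)
    qed
    moreover have "(if m \<in> monomial_nat ` U then comp_term f (inv_into U monomial_nat m) *
          of_nat (monomial_nat (inv_into U monomial_nat m)) powr (- s) else 0) = b m * of_nat m powr (- s)" for m
      by (simp add: b_def f_inv_into_f)
    ultimately have "(\<lambda>m. b m * of_nat m powr (- s)) sums (\<Sum>j. log_functional \<sigma> f j * (z ^ j / fact j))"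
      by (simp add: group)
    then have "eval_hd (Abs_hardy_dirichlet b) s = (\<Sum>j. log_functional \<sigma> f j * (z ^ j / fact j))"
      unfolding eval_hd_def g by (rule sums_unique[symmetric])
    then show "eval_hd (Abs_hardy_dirichlet b) s = eval_hd f (symbol s)"
      unfolding symbol_eq eval_hd_expansion[OF z_less] .
  qed
qed

lemma norm_composition_square:
  "(norm (composition_hd symbol f))\<^sup>2 = (\<Sum>j. (a_coeff d r j)\<^sup>2 * (cmod (log_functional \<sigma> f j))\<^sup>2)"
proof -
  obtain g where g: "\<And>s. Re s > 1 / 2 \<Longrightarrow> eval_hd g s = eval_hd f (symbol s)"
      and norm_g: "(norm g)\<^sup>2 = (\<Sum>j. (a_coeff d r j)\<^sup>2 * (cmod (log_functional \<sigma> f j))\<^sup>2)"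
    using composition_exists by blast
  have "composition_hd symbol f = g"
    unfolding composition_hd_def
    by (rule the_equality) (auto simp: g intro!: eval_hd_inject)
  with norm_g show ?thesis by simp
qed

end

section \<open>The truncation error\<close>

lemma lambda_max_eq:
  "lambda_max N M \<sigma> d r = Max (spectrum (mat N N (\<lambda>(i, j).
     \<Sum>n\<in>{1..M}. (a_coeff d r i * log_weight \<sigma> i n) * (a_coeff d r j * log_weight \<sigma> j n))))"
proof -
  have "log_moment M (i + j) \<sigma> * a_coeff d r i * a_coeff d r j
      = (\<Sum>n\<in>{1..M}. (a_coeff d r i * log_weight \<sigma> i n) * (a_coeff d r j * log_weight \<sigma> j n))" for i j
    unfolding log_moment_def log_weight_mult[symmetric] sum_distrib_right
    by (intro sum.cong refl) (simp add: mult_ac)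
  then show ?thesis by (simp add: lambda_max_def B_mat_def)
qed

text \<open>The triangle inequality in L2 followed by Cauchy-Schwarz for two-component vectors. It
  lets bounds on orthogonal parts of f combine into \<mu> + \<nu> without a mixed term.\<close>

lemma sum_norm_add_square_le:
  fixes a b :: "'i \<Rightarrow> complex"
  assumes A: "(\<Sum>j\<in>J. (cmod (a j))\<^sup>2) \<le> \<mu> * x" and B: "(\<Sum>j\<in>J. (cmod (b j))\<^sup>2) \<le> \<nu> * y"
    and nonneg: "\<mu> \<ge> 0" "\<nu> \<ge> 0" "x \<ge> 0" "y \<ge> 0"
  shows "(\<Sum>j\<in>J. (cmod (a j + b j))\<^sup>2) \<le> (\<mu> + \<nu>) * (x + y)"
proof -
  have "(\<Sum>j\<in>J. (cmod (a j + b j))\<^sup>2) = (L2_set (\<lambda>j. cmod (a j + b j)) J)\<^sup>2"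
    by (simp add: L2_set_def sum_nonneg)
  also have "\<dots> \<le> (L2_set (\<lambda>j. cmod (a j)) J + L2_set (\<lambda>j. cmod (b j)) J)\<^sup>2"
    by (intro power_mono L2_set_nonneg order_trans[OF _ L2_set_triangle_ineq] L2_set_mono)
       (auto simp: norm_triangle_ineq)
  also have "\<dots> \<le> (sqrt \<mu> * sqrt x + sqrt \<nu> * sqrt y)\<^sup>2"
    using A B by (intro power_mono add_mono add_nonneg_nonneg L2_set_nonneg)
      (simp_all add: L2_set_def flip: real_sqrt_mult)
  \<comment> \<open>The difference of the two sides is the square of sqrt \<mu> sqrt y - sqrt \<nu>
    sqrt x.\<close>
  also have "\<dots> \<le> (\<mu> + \<nu>) * (x + y)"
    using nonneg zero_le_power2[of "sqrt \<mu> * sqrt y - sqrt \<nu> * sqrt x"]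
    by (simp add: power2_sum power2_diff power_mult_distrib algebra_simps)
  finally show ?thesis .
qed

section \<open>Upper bound: rows and columns outside the corner\<close>

lemma norm_log_functional_square_le:
  assumes "0 < \<epsilon>" "\<epsilon> < 2 * \<sigma> - 1"
  shows "(cmod (log_functional \<sigma> f j))\<^sup>2
    \<le> fact (2 * j) / \<epsilon> ^ (2 * j) * zeta_real (2 * \<sigma> - \<epsilon>) * (norm f)\<^sup>2"
proof -
  have "(cmod (log_functional \<sigma> f j))\<^sup>2 \<le> (norm f)\<^sup>2 * (\<Sum>n. (log_weight \<sigma> j n)\<^sup>2)"
    unfolding log_functional_def norm_hd_square
    by (rule Cauchy_Schwarz_suminf(2)[OF summable_coeff_hd summable_log_weight_square[OF assms]])
  also have "\<dots> \<le> (norm f)\<^sup>2 * (fact (2 * j) / \<epsilon> ^ (2 * j) * zeta_real (2 * \<sigma> - \<epsilon>))"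
    by (intro mult_left_mono suminf_log_weight_square_le assms) simp
  finally show ?thesis by (simp add: mult_ac)
qed

context dirichlet_polynomial_symbol
begin

context
  fixes \<epsilon> :: real
  assumes \<epsilon>_gt: "2 * (\<Sum>i=1..d. r i) < \<epsilon>" and \<epsilon>_less: "\<epsilon> < 2 * \<sigma> - 1"
begin

lemma \<epsilon>_pos: "\<epsilon> > 0"
  using \<epsilon>_gt sum_r_nonneg by linarith

lemma zeta_nonneg: "zeta_real (2 * \<sigma> - \<epsilon>) \<ge> 0"
proof -
  have x: "2 * \<sigma> - \<epsilon> > 1" using \<epsilon>_less by simp
  show ?thesis
    unfolding zeta_real_eq[OF x] by (intro suminf_nonneg summable_powr_minus x) simp
qed

lemma rows_tail_le:
  "(\<Sum>j. (a_coeff d r (j + N))\<^sup>2 * (cmod (log_functional \<sigma> f (j + N)))\<^sup>2)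
    \<le> E_error N \<sigma> d r \<epsilon> * (norm f)\<^sup>2"
proof -
  define q where "q = 4 * (\<Sum>i=1..d. r i)\<^sup>2 / \<epsilon>\<^sup>2"
  \<comment> \<open>The lower bound on \<epsilon> enters here, making the geometric ratio q smaller
    than 1.\<close>
  have "(2 * (\<Sum>i=1..d. r i))\<^sup>2 < \<epsilon>\<^sup>2"
    using \<epsilon>_gt sum_r_nonneg by (intro power_strict_mono) auto
  then have q: "0 \<le> q" "q < 1"
    using \<epsilon>_pos by (auto simp: q_def power_mult_distrib)
  let ?C = "zeta_real (2 * \<sigma> - \<epsilon>) * (norm f)\<^sup>2"
  have le: "(a_coeff d r j)\<^sup>2 * (cmod (log_functional \<sigma> f j))\<^sup>2 \<le> ?C * q ^ j" for j
  proof -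
    have "(a_coeff d r j)\<^sup>2 * (cmod (log_functional \<sigma> f j))\<^sup>2
        \<le> (a_coeff d r j)\<^sup>2 * (fact (2 * j) / \<epsilon> ^ (2 * j) * zeta_real (2 * \<sigma> - \<epsilon>) * (norm f)\<^sup>2)"
      using \<epsilon>_pos \<epsilon>_less by (intro mult_left_mono norm_log_functional_square_le) auto
    also have "\<dots> = ((a_coeff d r j)\<^sup>2 * (fact (2 * j) / \<epsilon> ^ (2 * j))) * ?C" by (simp add: mult_ac)
    also have "\<dots> \<le> q ^ j * ?C"
      unfolding q_def using zeta_nonneg \<epsilon>_pos
      by (intro mult_right_mono a_coeff_square_fact_le r_nonneg) auto
    finally show ?thesis by (simp add: mult.commute)
  qed
  have geo: "(\<lambda>j. ?C * q ^ N * q ^ j) sums (?C * q ^ N * (1 / (1 - q)))"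
    using q by (intro sums_mult geometric_sums) auto
  have "(\<Sum>j. (a_coeff d r (j + N))\<^sup>2 * (cmod (log_functional \<sigma> f (j + N)))\<^sup>2) \<le> (\<Sum>j. ?C * q ^ N * q ^ j)"
    using le[of "_ + N"] summable_ignore_initial_segment[OF summable_a_coeff_log_functional, of N]
    by (intro suminf_le sums_summable[OF geo]) (auto simp: power_add mult_ac)
  also have "\<dots> = E_error N \<sigma> d r \<epsilon> * (norm f)\<^sup>2"
    using sums_unique[OF geo] by (simp add: E_error_def Let_def q_def mult_ac)
  finally show ?thesis .
qed

text \<open>Each row is cut after column M into A + B. The two parts involve only the masses x and y
  of f, with x + y the squared norm, so \<open>sum_norm_add_square_le\<close> joins the eigenvalue
  bound for A to the Cauchy-Schwarz bound for B.\<close>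

lemma rows_head_le:
  assumes N: "N \<ge> 1" and M: "M \<ge> 1"
  shows "(\<Sum>j<N. (a_coeff d r j)\<^sup>2 * (cmod (log_functional \<sigma> f j))\<^sup>2)
    \<le> (lambda_max N M \<sigma> d r + eta_error N M \<sigma> d r \<epsilon>) * (norm f)\<^sup>2"
proof -
  define K where "K = (\<lambda>j n. a_coeff d r j * log_weight \<sigma> j n)"
  define A where "A = (\<lambda>j. \<Sum>n\<in>{1..M}. coeff_hd f n * of_real (K j n))"
  define B where "B = (\<lambda>j. of_real (a_coeff d r j) *
    (\<Sum>n. coeff_hd f (n + Suc M) * of_real (log_weight \<sigma> j (n + Suc M))))"
  define x where "x = (\<Sum>n\<in>{1..M}. (cmod (coeff_hd f n))\<^sup>2)"
  define y where "y = (\<Sum>n. (cmod (coeff_hd f (n + Suc M)))\<^sup>2)"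
  note lw = summable_log_weight_square[OF \<epsilon>_pos \<epsilon>_less]
  \<comment> \<open>Splitting a series at \<open>Suc M\<close> leaves \<open>{..<Suc M}\<close>,
    which differs from \<open>{1..M}\<close> by the vanishing index 0.\<close>
  have init: "(\<Sum>n<Suc M. h n) = (\<Sum>n\<in>{1..M}. h n)" if "h 0 = 0" for h :: "nat \<Rightarrow> 'c :: comm_monoid_add"
    using that by (intro sum.mono_neutral_right) (auto simp: Suc_le_eq)
  have norm_f: "(norm f)\<^sup>2 = x + y"
    unfolding norm_hd_square suminf_split_initial_segment[OF summable_coeff_hd, of f "Suc M"] x_def y_def
    by (subst init) auto
  have y: "y \<ge> 0"
    unfolding y_def by (intro suminf_nonneg summable_ignore_initial_segment[OF summable_coeff_hd]) simp
  have x: "x \<ge> 0" by (simp add: x_def sum_nonneg)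
  have AB: "of_real (a_coeff d r j) * log_functional \<sigma> f j = A j + B j" for j
  proof -
    have "summable (\<lambda>n. coeff_hd f n * of_real (log_weight \<sigma> j n))"
      by (rule summable_norm_cancel)
         (use Cauchy_Schwarz_suminf(1)[OF summable_coeff_hd[of f] lw[of j]] in \<open>simp add: norm_mult\<close>)
    from suminf_split_initial_segment[OF this, of "Suc M"]
    have "log_functional \<sigma> f j = (\<Sum>n. coeff_hd f (n + Suc M) * of_real (log_weight \<sigma> j (n + Suc M)))
        + (\<Sum>n\<in>{1..M}. coeff_hd f n * of_real (log_weight \<sigma> j n))"
      unfolding log_functional_def
      by (simp only: init[of "\<lambda>n. coeff_hd f n * of_real (log_weight \<sigma> j n)"] coeff_hd_0 mult_zero_left)
    then show ?thesis
      by (simp add: A_def B_def K_def distrib_left sum_distrib_left mult_ac)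
  qed
  have head: "(\<Sum>j<N. (cmod (A j))\<^sup>2) \<le> lambda_max N M \<sigma> d r * x"
    unfolding A_def x_def lambda_max_eq K_def by (rule gram_spectrum_bound[OF N])
  have B_le: "(cmod (B j))\<^sup>2 \<le> fact (2 * j) / \<epsilon> ^ (2 * j) * (a_coeff d r j)\<^sup>2 *
      (real M powr - (2 * \<sigma> - \<epsilon> - 1) / (2 * \<sigma> - \<epsilon> - 1)) * y" for j
  proof -
    have "(cmod (\<Sum>n. coeff_hd f (n + Suc M) * of_real (log_weight \<sigma> j (n + Suc M))))\<^sup>2
        \<le> y * (\<Sum>n. (log_weight \<sigma> j (n + Suc M))\<^sup>2)"
      unfolding y_def
      by (rule Cauchy_Schwarz_suminf(2)[OF summable_ignore_initial_segment[OF summable_coeff_hd]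
            summable_ignore_initial_segment[OF lw]])
    also have "\<dots> \<le> y * (fact (2 * j) / \<epsilon> ^ (2 * j) * (real M powr - (2 * \<sigma> - \<epsilon> - 1) / (2 * \<sigma> - \<epsilon> - 1)))"
      using y by (intro mult_left_mono log_weight_square_tail_le[OF \<epsilon>_pos \<epsilon>_less M])
    finally have "(a_coeff d r j)\<^sup>2 * (cmod (\<Sum>n. coeff_hd f (n + Suc M) * of_real (log_weight \<sigma> j (n + Suc M))))\<^sup>2
        \<le> (a_coeff d r j)\<^sup>2 * (y * (fact (2 * j) / \<epsilon> ^ (2 * j) * (real M powr - (2 * \<sigma> - \<epsilon> - 1) / (2 * \<sigma> - \<epsilon> - 1))))"
      by (rule mult_left_mono) simp
    then show ?thesis
      by (simp add: B_def norm_mult power_mult_distrib mult_ac)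
  qed
  have tail: "(\<Sum>j<N. (cmod (B j))\<^sup>2) \<le> eta_error N M \<sigma> d r \<epsilon> * y"
    unfolding eta_error_def sum_distrib_right by (intro sum_mono B_le)
  have eta: "eta_error N M \<sigma> d r \<epsilon> \<ge> 0"
    unfolding eta_error_def using \<epsilon>_pos \<epsilon>_less by (intro mult_nonneg_nonneg sum_nonneg) auto
  have lam: "lambda_max N M \<sigma> d r \<ge> 0"
    unfolding lambda_max_eq by (rule gram_spectrum_nonneg[OF N])
  have "(\<Sum>j<N. (a_coeff d r j)\<^sup>2 * (cmod (log_functional \<sigma> f j))\<^sup>2) = (\<Sum>j<N. (cmod (A j + B j))\<^sup>2)"
    by (simp add: norm_mult power_mult_distrib flip: AB)
  also have "\<dots> \<le> (lambda_max N M \<sigma> d r + eta_error N M \<sigma> d r \<epsilon>) * (x + y)"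
    by (rule sum_norm_add_square_le[OF head tail lam eta x y])
  finally show ?thesis by (simp add: norm_f)
qed

lemma norm_composition_square_le:
  assumes "N \<ge> 1" "M \<ge> 1"
  shows "(norm (composition_hd symbol f))\<^sup>2
    \<le> (lambda_max N M \<sigma> d r + (E_error N \<sigma> d r \<epsilon> + eta_error N M \<sigma> d r \<epsilon>)) * (norm f)\<^sup>2"
  unfolding norm_composition_square suminf_split_initial_segment[OF summable_a_coeff_log_functional, of f N]
  using rows_tail_le[of N f] rows_head_le[OF assms, of f] by (simp add: algebra_simps)

text \<open>\<open>onorm\<close> is a supremum of real quotients and is informative only if these
  are bounded; the estimate just obtained supplies that bound.\<close>

lemma onorm_composition:
  assumes "N \<ge> 1" "M \<ge> 1"
  shows onorm_composition_square_le: "(onorm (composition_hd symbol))\<^sup>2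
      \<le> lambda_max N M \<sigma> d r + (E_error N \<sigma> d r \<epsilon> + eta_error N M \<sigma> d r \<epsilon>)"
    and norm_composition_le_onorm:
      "norm (composition_hd symbol f) \<le> onorm (composition_hd symbol) * norm f"
    and onorm_composition_nonneg: "0 \<le> onorm (composition_hd symbol)"
proof -
  define c where "c = lambda_max N M \<sigma> d r + (E_error N \<sigma> d r \<epsilon> + eta_error N M \<sigma> d r \<epsilon>)"
  \<comment> \<open>The constant series 1: one nonzero element suffices to see that c \<ge> 0, so
    that sqrt c can serve as a norm bound.\<close>
  let ?h = "Abs_hardy_dirichlet (\<lambda>n. if n = 1 then 1 else 0)"
  have "coeff_hd ?h = (\<lambda>n. if n = 1 then 1 else 0)"
    by (intro Abs_hardy_dirichlet_inverse)
       (auto intro!: summable_finite[of "{1}"] split: if_splits)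
  then have "norm ?h \<noteq> 0"
    by (auto simp: coeff_hd_inject[symmetric] zero_hardy_dirichlet.rep_eq fun_eq_iff)
  moreover have "0 \<le> c * (norm ?h)\<^sup>2"
    using norm_composition_square_le[OF assms, of ?h] order_trans[OF zero_le_power2]
    unfolding c_def by blast
  ultimately have c: "c \<ge> 0"
    by (simp add: zero_le_mult_iff)
  have bound: "norm (composition_hd symbol g) \<le> sqrt c * norm g" for g
  proof (rule power2_le_imp_le)
    show "(norm (composition_hd symbol g))\<^sup>2 \<le> (sqrt c * norm g)\<^sup>2"
      using norm_composition_square_le[OF assms, of g] c by (simp add: power_mult_distrib c_def)
  qed (simp add: c)
  have bdd: "bdd_above (range (\<lambda>g. norm (composition_hd symbol g) / norm g))"
  proof (rule bdd_aboveI2)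
    show "norm (composition_hd symbol g) / norm g \<le> sqrt c" for g
      using bound[of g] c by (cases "g = 0") (simp_all add: pos_divide_le_eq)
  qed
  have up: "norm (composition_hd symbol g) / norm g \<le> onorm (composition_hd symbol)" for g
    unfolding onorm_def by (rule cSUP_upper[OF _ bdd]) simp
  \<comment> \<open>At g = 0 the quotient has denominator 0 and hence the value 0.\<close>
  show nonneg: "0 \<le> onorm (composition_hd symbol)"
    using up[of 0] by simp
  have "onorm (composition_hd symbol) \<le> sqrt c"
    by (rule onorm_bound) (use bound c in auto)
  then have "(onorm (composition_hd symbol))\<^sup>2 \<le> (sqrt c)\<^sup>2"
    by (rule power_mono) (rule nonneg)
  with c show "(onorm (composition_hd symbol))\<^sup>2
      \<le> lambda_max N M \<sigma> d r + (E_error N \<sigma> d r \<epsilon> + eta_error N M \<sigma> d r \<epsilon>)"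
    by (simp add: c_def)
  show "norm (composition_hd symbol f) \<le> onorm (composition_hd symbol) * norm f"
  proof (cases "f = 0")
    case True
    then show ?thesis using bound[of f] by simp
  next
    case False
    then show ?thesis using up[of f] by (simp add: pos_divide_le_eq)
  qed
qed

text \<open>An extremal vector of the corner is the coefficient vector of a Dirichlet polynomial f.
  Dropping the rows j \<ge> N can only decrease the squared norm of its image, so f tests the
  operator norm.\<close>

lemma lambda_max_le_onorm_square:
  assumes "N \<ge> 1" "M \<ge> 1"
  shows "lambda_max N M \<sigma> d r \<le> (onorm (composition_hd symbol))\<^sup>2"
proof (cases "lambda_max N M \<sigma> d r > 0")
  case True
  let ?K = "\<lambda>j n. a_coeff d r j * log_weight \<sigma> j n"
  obtain c where c: "(\<Sum>n\<in>{1..M}. (c n)\<^sup>2) > (0 :: real)"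
    "(\<Sum>j<N. (\<Sum>n\<in>{1..M}. c n * ?K j n)\<^sup>2) = lambda_max N M \<sigma> d r * (\<Sum>n\<in>{1..M}. (c n)\<^sup>2)"
    using gram_spectrum_attained[OF assms(1), of ?K "{1..M}"] True
    unfolding lambda_max_eq by blast
  define b where "b = (\<lambda>n. if n \<in> {1..M} then of_real (c n) else (0 :: complex))"
  define f where "f = Abs_hardy_dirichlet b"
  have f: "coeff_hd f = b"
    unfolding f_def
    by (intro Abs_hardy_dirichlet_inverse) (auto simp: b_def intro!: summable_finite[of "{1..M}"])
  \<comment> \<open>Kept general in h to serve both the norm of f and the functionals L_j f.\<close>
  have fin: "(\<Sum>n. h (b n) n) = (\<Sum>n\<in>{1..M}. h (of_real (c n)) n)"
    if "\<And>n. h 0 n = 0" for h :: "complex \<Rightarrow> nat \<Rightarrow> 'c :: {t2_space, topological_comm_monoid_add}"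
    by (subst suminf_finite[of "{1..M}"]) (auto simp: b_def that)
  have norm_f: "(norm f)\<^sup>2 = (\<Sum>n\<in>{1..M}. (c n)\<^sup>2)"
    unfolding norm_hd_square f using fin[of "\<lambda>x n. (cmod x)\<^sup>2"] by simp
  have L: "log_functional \<sigma> f j = of_real (\<Sum>n\<in>{1..M}. c n * log_weight \<sigma> j n)" for j
    unfolding log_functional_def f using fin[of "\<lambda>x n. x * of_real (log_weight \<sigma> j n)"] by simp
  have "(a_coeff d r j)\<^sup>2 * (cmod (log_functional \<sigma> f j))\<^sup>2 = (\<Sum>n\<in>{1..M}. c n * ?K j n)\<^sup>2" for j
    unfolding L norm_of_real power2_abs power_mult_distrib[symmetric] sum_distrib_left
    by (simp add: mult_ac)
  then have "lambda_max N M \<sigma> d r * (norm f)\<^sup>2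
      = (\<Sum>j<N. (a_coeff d r j)\<^sup>2 * (cmod (log_functional \<sigma> f j))\<^sup>2)"
    by (simp only: c(2) norm_f)
  also have "\<dots> \<le> (norm (composition_hd symbol f))\<^sup>2"
    unfolding norm_composition_square
    by (intro sum_le_suminf summable_a_coeff_log_functional) auto
  also have "\<dots> \<le> (onorm (composition_hd symbol) * norm f)\<^sup>2"
    by (intro power_mono norm_composition_le_onorm[OF assms]) simp
  finally show ?thesis
    using c(1) by (simp add: power_mult_distrib norm_f)
next
  case False
  then show ?thesis by (smt (verit) zero_le_power2)
qed

end

end

theorem theorem5p7:
  fixes d :: nat and p :: "nat \<Rightarrow> nat" and r :: "nat \<Rightarrow> real"
    and \<sigma> \<epsilon> R :: real and \<phi> :: "complex \<Rightarrow> complex" and N M :: nat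
  assumes "d \<ge> 1"
    and "\<And>j. j \<in> {1..d} \<Longrightarrow> prime (p j)" and "inj_on p {1..d}"
    and "\<phi> = (\<lambda>s. of_real \<sigma> + (\<Sum>j=1..d. of_real (r j) * of_nat (p j) powr (- s)))"
    and "\<sigma> > 1/2"
    and "\<And>j. j \<in> {1..d} \<Longrightarrow> r j \<ge> 0"
    and "R = (\<Sum>j=1..d. r j)" and "R < \<sigma> - 1/2"
    and "2 * R < \<epsilon>" and "\<epsilon> < 2 * \<sigma> - 1"
    and "N \<ge> 1" and "M \<ge> 1"
  shows "0 \<le> (onorm (composition_hd \<phi>))\<^sup>2 - lambda_max N M \<sigma> d r \<and>
    (onorm (composition_hd \<phi>))\<^sup>2 - lambda_max N M \<sigma> d r
      \<le> E_error N \<sigma> d r \<epsilon> + eta_error N M \<sigma> d r \<epsilon>"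
proof -
  interpret dirichlet_polynomial_symbol d p r \<sigma>
    using assms by unfold_locales auto
  have phi: "\<phi> = symbol"
    by (simp add: assms(4) symbol_def fun_eq_iff)
  have eps: "2 * (\<Sum>i=1..d. r i) < \<epsilon>" "\<epsilon> < 2 * \<sigma> - 1"
    using assms by auto
  show ?thesis
    unfolding phi
    using lambda_max_le_onorm_square[OF eps assms(11,12)] onorm_composition_square_le[OF eps assms(11,12)]
    by linarith
qed

end
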